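(* Let $X$ be a complex Banach space and let $A\colon D(A)\to X$, $D(A)\subset X$, be a closed, possibly unbounded, linear operator. Assume that all the complex numbers $\mu_k=\mathrm{i}k$, $k=\pm1,\pm2,\dots$, are regular points of $A$ and that there is a constant $C>0$ such that $$\|(A-\mu_k I)^{-1}\|\le \frac{C}{|k|},\qquad k=\pm1,\pm2,\dots .$$ Let $f\in D(A^2)$. Then the problem $$\frac{dv}{dt}=Av,\quad 0<t<2\pi,\qquad \frac{1}{2\pi}\int_0^{2\pi}v(t)\,dt=f \qquad (\mathrm{P})$$ has a unique solution (in the sense given in the context), and this solution is given for $t\in[0,2\pi]$ by $$v(t)=f+(t-\pi)Af+2\left(\sum_{k=1}^{\infty}\Sigma_k(Af)\cos kt+\sum_{k=1}^{\infty}\Upsilon_k(Af)\sin kt\right),$$ where, for $k=1,2,\dots$, $$\Sigma_k=A(A+\mathrm{i}kI)^{-1}(A-\mathrm{i}kI)^{-1},\qquad \Upsilon_k=k^{-1}A^2(A+\mathrm{i}kI)^{-1}(A-\mathrm{i}kI)^{-1}.$$ Moreover, for any integer $n\ge 0$, under the additional assumption $f\in D(A^{2n+2})$, the solution $v(t)$ of $(\mathrm{P})$ satisfies $$v(t)=p_n(t)+s_n(t)$$ with $$p_n(t)=\sum_{k=0}^{2n+1}\frac{(2\pi)^k}{k!}\,B_k\!\left(\frac{t}{2\pi}\right)A^kf$$ and $$s_n(t)=(-1)^n\,2\sum_{k=1}^{\infty}\frac{1}{k^{2n}}\left(\Sigma_k(A^{2n+1}f)\cos kt+\Upsilon_k(A^{2n+1}f)\sin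 kt\right),$$ where $B_m$ denotes the $m$-th Bernoulli polynomial, $$B_m(t)=\sum_{j=0}^{m}\frac{1}{j+1}\sum_{k=0}^{j}(-1)^k\binom{j}{k}(t+k)^m .$$
   Context: $I$ is the identity operator on $X$. A number $\lambda\in\mathbb{C}$ is called a regular point of $A$ if $A-\lambda I\colon D(A)\to X$ is bijective and $(A-\lambda I)^{-1}$ is a bounded operator on $X$. $D(A^m)$ denotes the natural domain of the power $A^m$, i.e. $D(A^1)=D(A)$ and $D(A^{m+1})=\{x\in D(A^m): A^m x\in D(A)\}$. A solution of problem $(\mathrm{P})$ means a continuous function $v\colon[0,2\pi]\to X$ with $v(t)\in D(A)$ for $0<t<2\pi$, such that $v\in \mathcal{C}^1((0,2\pi);X)$ and $Av\in\mathcal{C}((0,2\pi);X)$, and such that both the differential equation and the integral condition in $(\mathrm{P})$ hold. Infinite series of elements of $X$ are understood as limits of partial sums in the norm of $X$. *)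

theory Defs
  imports "HOL-Analysis.Analysis"
begin

class complex_banach = banach +
  fixes scaleC :: "complex \<Rightarrow> 'a \<Rightarrow> 'a"  (infixr "*\<^sub>C" 75)
  assumes scaleC_add_right: "a *\<^sub>C (x + y) = a *\<^sub>C x + a *\<^sub>C y"
    and scaleC_add_left: "(a + b) *\<^sub>C x = a *\<^sub>C x + b *\<^sub>C x"
    and scaleC_scaleC: "a *\<^sub>C (b *\<^sub>C x) = (a * b) *\<^sub>C x"
    and scaleC_of_real: "complex_of_real r *\<^sub>C x = r *\<^sub>R x"
    and norm_scaleC: "norm (a *\<^sub>C x) = cmod a * norm x"

interpretation complex_vector:
  vector_space "scaleC :: complex \<Rightarrow> 'a \<Rightarrow> 'a::complex_banach"
proof
  show "1 *\<^sub>C x = x" for x :: 'a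
    using scaleC_of_real[of 1 x] by simp
qed (simp_all add: scaleC_add_right scaleC_add_left scaleC_scaleC)

instantiation complex :: complex_banach
begin
definition scaleC_complex :: "complex \<Rightarrow> complex \<Rightarrow> complex" where
  "scaleC_complex a x = a * x"
instance
  by standard
    (simp_all add: scaleC_complex_def algebra_simps norm_mult scaleR_conv_of_real)
end

text \<open>
  A partially defined operator is a pair of its domain \<open>D\<close> and a total function \<open>A\<close>
  of which only the values on \<open>D\<close> matter.
\<close>

definition closed_linear_operator :: "'a::complex_banach set \<Rightarrow> ('a \<Rightarrow> 'a) \<Rightarrow> bool" where
  "closed_linear_operator D A \<longleftrightarrow>
     complex_vector.subspace D \<and>
     (\<forall>x\<in>D. \<forall>y\<in>D. A (x + y) = A x + A y) \<and>
     (\<forall>c. \<forall>x\<in>D. A (c *\<^sub>C x) = c *\<^sub>C A x) \<and>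
     closed {(x, A x) | x. x \<in> D}"

definition shifted :: "('a::complex_banach \<Rightarrow> 'a) \<Rightarrow> complex \<Rightarrow> 'a \<Rightarrow> 'a" where
  "shifted A \<mu> x = A x - \<mu> *\<^sub>C x"

definition resolvent :: "'a::complex_banach set \<Rightarrow> ('a \<Rightarrow> 'a) \<Rightarrow> complex \<Rightarrow> 'a \<Rightarrow> 'a" where
  "resolvent D A \<mu> = inv_into D (shifted A \<mu>)"

text \<open>
  \<^const>\<open>bounded_linear\<close> is real-linear; when \<open>A\<close> is complex linear on \<open>D\<close>, the inverse is
  automatically complex linear.
\<close>

definition regular_point :: "'a::complex_banach set \<Rightarrow> ('a \<Rightarrow> 'a) \<Rightarrow> complex \<Rightarrow> bool" where
  "regular_point D A \<mu> \<longleftrightarrow>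
     bij_betw (shifted A \<mu>) D UNIV \<and> bounded_linear (resolvent D A \<mu>)"

primrec power_domain :: "'a set \<Rightarrow> ('a \<Rightarrow> 'a) \<Rightarrow> nat \<Rightarrow> 'a set" where
  "power_domain D A 0 = UNIV"
| "power_domain D A (Suc m) = {x \<in> power_domain D A m. (A ^^ m) x \<in> D}"

definition is_solution ::
  "'a::complex_banach set \<Rightarrow> ('a \<Rightarrow> 'a) \<Rightarrow> 'a \<Rightarrow> (real \<Rightarrow> 'a) \<Rightarrow> bool" where
  "is_solution D A f v \<longleftrightarrow>
     continuous_on {0..2*pi} v \<and>
     (\<forall>t\<in>{0<..<2*pi}. v t \<in> D) \<and>
     v C1_differentiable_on {0<..<2*pi} \<and>
     continuous_on {0<..<2*pi} (\<lambda>t. A (v t)) \<and>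
     (\<forall>t\<in>{0<..<2*pi}. (v has_vector_derivative A (v t)) (at t)) \<and>
     (1 / (2*pi)) *\<^sub>R integral {0..2*pi} v = f"

definition Sigma_op :: "'a::complex_banach set \<Rightarrow> ('a \<Rightarrow> 'a) \<Rightarrow> nat \<Rightarrow> 'a \<Rightarrow> 'a" where
  "Sigma_op D A k x =
     A (resolvent D A (- (\<i> * of_nat k)) (resolvent D A (\<i> * of_nat k) x))"

definition Upsilon_op :: "'a::complex_banach set \<Rightarrow> ('a \<Rightarrow> 'a) \<Rightarrow> nat \<Rightarrow> 'a \<Rightarrow> 'a" where
  "Upsilon_op D A k x =
     (1 / real k) *\<^sub>R
       (A ^^ 2) (resolvent D A (- (\<i> * of_nat k)) (resolvent D A (\<i> * of_nat k) x))"

definition bernoulli_poly :: "nat \<Rightarrow> real \<Rightarrow> real" where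
  "bernoulli_poly m t =
     (\<Sum>j=0..m. 1 / (real j + 1) *
        (\<Sum>k=0..j. (-1) ^ k * real (j choose k) * (t + real k) ^ m))"

definition poly_part :: "('a::real_vector \<Rightarrow> 'a) \<Rightarrow> 'a \<Rightarrow> nat \<Rightarrow> real \<Rightarrow> 'a" where
  "poly_part A f n t =
     (\<Sum>k=0..2*n+1. ((2*pi) ^ k / fact k * bernoulli_poly k (t / (2*pi))) *\<^sub>R (A ^^ k) f)"

end

theory Submission
  imports Defs
begin

text \<open>
  Put \<open>h = A\<^sup>2 f\<close>, \<open>R\<^sub>k = (A - i k I)\<^sup>-\<^sup>1\<close>, \<open>T\<^sub>k = R\<^sub>-\<^sub>k R\<^sub>k\<close>. On \<open>A f\<close> the operators \<open>\<Sigma>\<^sub>k\<close> and \<open>k \<Upsilon>\<^sub>k\<close>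
  take the values \<open>T\<^sub>k h\<close> and \<open>A T\<^sub>k h\<close>, so the series for \<open>v\<close> converges absolutely and uniformly. Its
  derivative has coefficients \<open>A T\<^sub>k h\<close> and \<open>k T\<^sub>k h\<close>, which are only \<open>O(1/k)\<close>; but they are combinations of
  \<open>R\<^sub>k h\<close> and \<open>R\<^sub>-\<^sub>k h\<close>, and the resolvent identity gives differences of order \<open>1/k\<^sup>2\<close>. Dirichlet's
  test therefore yields locally uniform convergence on \<open>(0, 2\<pi>)\<close>. Applying \<open>A\<close> to the partial sums produces
  the differentiated series plus a multiple of the sawtooth series \<open>\<Sum> sin(kt)/k\<close>, and closedness of \<open>A\<close>
  gives the equation. For uniqueness, integrating by parts against \<open>cos kt\<close> and \<open>sin kt\<close> turns the
  Fourier coefficients of the difference of two solutions into eigenvectors of \<open>A\<close> for \<open>\<plusminus>ik\<close>, which vanish.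
  The higher expansions follow from \<open>k\<^sup>2 T\<^sub>k = I - T\<^sub>k A\<^sup>2\<close> and the Fourier series of Bernoulli polynomials.
\<close>

subsection \<open>Trigonometric series with coefficients of bounded variation\<close>

text \<open>Summation by parts for \<open>q\<close> times the partial sums: since
  \<open>q * e k\<close> is a difference of the bounded functions \<open>F\<close>, what remains is
  boundary terms and a series dominated by the variation of \<open>a\<close>. The lower bound on
  \<open>q\<close> then permits division, uniformly on \<open>S\<close>.\<close>

lemma dirichlet_test_uniform:
  fixes a :: "nat \<Rightarrow> 'a::banach" and F e :: "nat \<Rightarrow> real \<Rightarrow> real" and q :: "real \<Rightarrow> real"
  assumes a: "a \<longlonglongrightarrow> 0" and var: "summable (\<lambda>k. norm (a k - a (Suc k)))"
    and F: "\<And>k t. \<bar>F k t\<bar> \<le> 1"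
    and e: "\<And>k t. q t * e k t = F (Suc k) t - F k t"
    and q: "\<And>t. t \<in> S \<Longrightarrow> q t \<ge> \<delta>" and \<delta>: "\<delta> > 0"
  shows "\<exists>G. uniform_limit S (\<lambda>n t. \<Sum>k<n. e k t *\<^sub>R a k) G sequentially"
proof -
  have parts: "q t *\<^sub>R (\<Sum>k<n. e k t *\<^sub>R a k) =
      F n t *\<^sub>R a n - F 0 t *\<^sub>R a 0 + (\<Sum>k<n. F (Suc k) t *\<^sub>R (a k - a (Suc k)))" for n t
  proof (induction n)
    case (Suc n)
    have "q t *\<^sub>R (\<Sum>k<Suc n. e k t *\<^sub>R a k)
        = q t *\<^sub>R (\<Sum>k<n. e k t *\<^sub>R a k) + (q t * e n t) *\<^sub>R a n"
      by (simp add: scaleR_add_right)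
    then show ?case
      unfolding Suc e by (simp add: algebra_simps)
  qed simp
  have 1: "uniform_limit S (\<lambda>n t. F n t *\<^sub>R a n) (\<lambda>t. 0) sequentially"
  proof (rule uniform_limitI)
    fix r :: real assume "r > 0"
    then have "\<forall>\<^sub>F n in sequentially. norm (a n) < r"
      using a by (simp add: tendsto_iff dist_norm)
    then show "\<forall>\<^sub>F n in sequentially. \<forall>t\<in>S. dist (F n t *\<^sub>R a n) 0 < r"
    proof eventually_elim
      case (elim n)
      have "\<bar>F n t\<bar> * norm (a n) \<le> norm (a n)" for t
        using mult_right_mono[OF F[of n t], of "norm (a n)"] by simp
      then show ?case using elim by (auto simp: dist_norm intro: le_less_trans)
    qed
  qed
  have 2: "uniform_limit S (\<lambda>n t. \<Sum>k<n. F (Suc k) t *\<^sub>R (a k - a (Suc k)))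
      (\<lambda>t. suminf (\<lambda>k. F (Suc k) t *\<^sub>R (a k - a (Suc k)))) sequentially"
    using mult_right_mono[OF F]
    by (intro Weierstrass_m_test[OF _ var]) fastforce
  obtain L where L: "uniform_limit S (\<lambda>n t. q t *\<^sub>R (\<Sum>k<n. e k t *\<^sub>R a k)) L sequentially"
    unfolding parts
    using uniform_limit_add[OF uniform_limit_minus[OF 1 uniform_limit_const[of "\<lambda>t. F 0 t *\<^sub>R a 0"]] 2] by blast
  have "uniform_limit S (\<lambda>n t. \<Sum>k<n. e k t *\<^sub>R a k) (\<lambda>t. L t /\<^sub>R q t) sequentially"
  proof (rule uniform_limitI)
    fix r :: real assume "r > 0"
    with \<delta> have "\<forall>\<^sub>F n in sequentially. \<forall>t\<in>S. dist (q t *\<^sub>R (\<Sum>k<n. e k t *\<^sub>R a k)) (L t) < r * \<delta>"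
      using L unfolding uniform_limit_iff by simp
    then show "\<forall>\<^sub>F n in sequentially. \<forall>t\<in>S. dist (\<Sum>k<n. e k t *\<^sub>R a k) (L t /\<^sub>R q t) < r"
    proof eventually_elim
      case (elim n)
      show ?case
      proof
        fix t assume t: "t \<in> S"
        let ?s = "\<Sum>k<n. e k t *\<^sub>R a k"
        have q0: "q t > 0" using q[OF t] \<delta> by simp
        have "q t *\<^sub>R ?s - L t = q t *\<^sub>R (?s - L t /\<^sub>R q t)"
          using q0 by (simp add: scaleR_diff_right)
        then have "dist (q t *\<^sub>R ?s) (L t) = q t * dist ?s (L t /\<^sub>R q t)"
          using q0 by (simp add: dist_norm)
        then have "q t * dist ?s (L t /\<^sub>R q t) < r * \<delta>"
          using elim t by auto
        also have "\<dots> \<le> q t * r"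
          using q[OF t] \<open>r > 0\<close> by (simp add: mult.commute)
        finally show "dist ?s (L t /\<^sub>R q t) < r"
          using q0 by simp
      qed
    qed
  qed
  then show ?thesis by blast
qed

text \<open>The factor \<open>2 * sin (t/2)\<close> used for the summation by parts vanishes at
  \<open>0\<close> and \<open>2*pi\<close>, so a uniform lower bound is sought on compact subsets of
  the open interval.\<close>

lemma sin_half_bounded_below:
  assumes "compact S" "S \<subseteq> {0<..<2*pi}"
  obtains \<delta> :: real where "\<delta> > 0" "\<And>t. t \<in> S \<Longrightarrow> 2 * sin (t/2) \<ge> \<delta>"
proof (cases "S = {}")
  case False
  have "continuous_on S (\<lambda>t. 2 * sin (t/2))" by (intro continuous_intros) auto
  then obtain s where "s \<in> S" "\<And>t. t \<in> S \<Longrightarrow> 2 * sin (s/2) \<le> 2 * sin (t/2)"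
    using continuous_attains_inf[OF assms(1) False] by blast
  moreover have "sin (s/2) > 0" using assms(2) \<open>s \<in> S\<close> by (intro sin_gt_zero) auto
  ultimately show ?thesis using that[of "2 * sin (s/2)"] by auto
qed (use that[of 1] in auto)

text \<open>Multiplication by \<open>2 * sin (t/2)\<close> turns each cosine into a difference of
  sines at neighbouring half-integer frequencies. The phase \<open>\<phi>\<close> covers cosine
  series (\<open>0\<close>) and sine series (\<open>pi/2\<close>) at once.\<close>

lemma trig_series_uniform:
  fixes a :: "nat \<Rightarrow> 'a::banach"
  assumes "a \<longlonglongrightarrow> 0" "summable (\<lambda>k. norm (a k - a (Suc k)))"
    and "compact S" "S \<subseteq> {0<..<2*pi}"
  shows "\<exists>G. uniform_limit S (\<lambda>n t. \<Sum>k<n. cos (real (Suc k) * t - \<phi>) *\<^sub>R a k) G sequentially"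
proof -
  obtain \<delta> :: real where \<delta>: "\<delta> > 0" "\<And>t. t \<in> S \<Longrightarrow> 2 * sin (t/2) \<ge> \<delta>"
    using sin_half_bounded_below[OF assms(3,4)] by blast
  have *: "2 * sin (t/2) * cos (real (Suc k) * t - \<phi>) =
      sin ((real (Suc k) + 1/2) * t - \<phi>) - sin ((real k + 1/2) * t - \<phi>)" for t k
  proof -
    have 1: "(real (Suc k) + 1/2) * t - \<phi> = (real (Suc k) * t - \<phi>) + t/2"
      and 2: "(real k + 1/2) * t - \<phi> = (real (Suc k) * t - \<phi>) - t/2"
      by (simp_all add: algebra_simps)
    show ?thesis unfolding 1 2 sin_add sin_diff by simp
  qed
  show ?thesis
    by (rule dirichlet_test_uniform[OF assms(1,2),
          where F = "\<lambda>k t. sin ((real k + 1/2) * t - \<phi>)" and q = "\<lambda>t. 2 * sin (t/2)" and \<delta> = \<delta>])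
      (use \<delta> * in auto)
qed

text \<open>Termwise differentiation under locally uniform convergence of the derivatives. The limit
  in \<open>unif\<close> may depend on \<open>S\<close>; uniqueness of pointwise limits identifies
  it with one \<open>G\<close>.\<close>

lemma series_has_vector_derivative:
  fixes f g :: "nat \<Rightarrow> real \<Rightarrow> 'a::banach"
  assumes deriv: "\<And>n t. (f n has_vector_derivative g n t) (at t)"
    and cont: "\<And>n. continuous_on UNIV (g n)"
    and unif: "\<And>S. compact S \<Longrightarrow> S \<subseteq> {a<..<b} \<Longrightarrow>
        \<exists>G. uniform_limit S (\<lambda>n t. \<Sum>k<n. g k t) G sequentially"
    and sums: "\<And>t. t \<in> {a<..<b} \<Longrightarrow> (\<lambda>n. f n t) sums F t"
  obtains G where "\<And>t. t \<in> {a<..<b} \<Longrightarrow> (F has_vector_derivative G t) (at t)"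
    and "\<And>t. t \<in> {a<..<b} \<Longrightarrow> (\<lambda>n. g n t) sums G t"
    and "continuous_on {a<..<b} G"
proof -
  define G where "G t = (\<Sum>k. g k t)" for t
  have ul: "uniform_limit S (\<lambda>n t. \<Sum>k<n. g k t) G sequentially"
    if S: "compact S" "S \<subseteq> {a<..<b}" for S
  proof -
    obtain H where H: "uniform_limit S (\<lambda>n t. \<Sum>k<n. g k t) H sequentially"
      using unif[OF S] by blast
    have "H t = G t" if "t \<in> S" for t
      using tendsto_uniform_limitI[OF H that] by (simp add: G_def sums_def[symmetric] sums_iff)
    then have "uniform_limit S (\<lambda>n t. \<Sum>k<n. g k t) H sequentially =
        uniform_limit S (\<lambda>n t. \<Sum>k<n. g k t) G sequentially"
      by (intro uniform_limit_cong') auto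
    then show ?thesis using H by simp
  qed
  have local: "(F has_vector_derivative G t) (at t) \<and> (\<lambda>n. g n t) sums G t \<and> isCont G t"
    if t: "t \<in> {a<..<b}" for t
  proof -
    obtain c d where cd: "a < c" "c < t" "t < d" "d < b"
      using t dense by (metis greaterThanLessThan_iff)
    have ul': "uniform_limit {c..d} (\<lambda>n t. \<Sum>k<n. g k t) G sequentially"
      using cd by (intro ul) auto
    have tcd: "t \<in> {c..d}" "t \<in> interior {c..d}" using cd by auto
    have conts: "continuous_on {c..d} G"
      by (rule uniform_limit_theorem[OF _ ul'])
        (auto intro!: always_eventually continuous_on_sum continuous_on_subset[OF cont])
    \<comment> \<open>The criterion starts from convergence at the single point \<open>t\<close> and
      supplies some limit \<open>h\<close> on \<open>{c..d}\<close>, identified with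
      \<open>F\<close> afterwards.\<close>
    have "\<exists>h. \<forall>x\<in>{c..d}. (\<lambda>n. \<Sum>k<n. f k x) \<longlonglongrightarrow> h x \<and>
        (h has_derivative (\<lambda>y. y *\<^sub>R G x)) (at x within {c..d})"
    proof (rule has_derivative_sequence[where f' = "\<lambda>n x y. y *\<^sub>R (\<Sum>k<n. g k x)"])
      show "((\<lambda>x. \<Sum>k<n. f k x) has_derivative (\<lambda>y. y *\<^sub>R (\<Sum>k<n. g k x))) (at x within {c..d})" for n x
        unfolding has_vector_derivative_def[symmetric]
        by (intro has_vector_derivative_sum has_vector_derivative_at_within[OF deriv])
      show "\<forall>\<^sub>F n in sequentially. \<forall>x\<in>{c..d}. \<forall>h. norm (h *\<^sub>R (\<Sum>k<n. g k x) - h *\<^sub>R G x) \<le> e * norm h"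
        if "e > 0" for e
        using uniform_limitD[OF ul' that]
      proof eventually_elim
        case (elim n)
        then have "norm h * norm ((\<Sum>k<n. g k x) - G x) \<le> norm h * e" if "x \<in> {c..d}" for x and h :: real
          using that by (intro mult_left_mono) (auto simp: dist_norm intro: less_imp_le)
        then show ?case
          by (simp add: scaleR_diff_right[symmetric] mult.commute del: scaleR_diff_right)
      qed
      show "(\<lambda>n. \<Sum>k<n. f k t) \<longlonglongrightarrow> F t" using sums[OF t] by (simp add: sums_def)
    qed (use tcd in auto)
    then obtain h where h: "\<And>x. x \<in> {c..d} \<Longrightarrow> (\<lambda>n. \<Sum>k<n. f k x) \<longlonglongrightarrow> h x"
      and h': "\<And>x. x \<in> {c..d} \<Longrightarrow> (h has_vector_derivative G x) (at x within {c..d})"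
      unfolding has_vector_derivative_def by blast
    have hF: "h x = F x" if "x \<in> {c..d}" for x
      using that cd sums[of x] LIMSEQ_unique[OF h[OF that]] by (auto simp: sums_def)
    have "(F has_vector_derivative G t) (at t within {c..d})"
      using has_vector_derivative_transform[OF tcd(1) hF[symmetric] h'[OF tcd(1)]] by simp
    then have "(F has_vector_derivative G t) (at t)"
      using at_within_interior[OF tcd(2)] by simp
    moreover have "isCont G t" using continuous_on_interior[OF conts tcd(2)] .
    moreover have "(\<lambda>n. g n t) sums G t"
      using tendsto_uniform_limitI[OF ul' tcd(1)] by (simp add: sums_def)
    ultimately show ?thesis by blast
  qed
  show ?thesis
    using local by (intro that[of G]) (auto intro: continuous_at_imp_continuous_on)
qed

section \<open>The Dirichlet kernel and the sawtooth series\<close>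

lemma sum_cos_multiples:
  "2 * sin (t/2) * (\<Sum>k<n. cos (real (Suc k) * t)) = sin ((real n + 1/2) * t) - sin (t/2)"
proof (induction n)
  case (Suc n)
  have 1: "(real (Suc n) + 1/2) * t = real (Suc n) * t + t/2"
    and 2: "(real n + 1/2) * t = real (Suc n) * t - t/2"
    by (simp_all add: algebra_simps)
  have "2 * sin (t/2) * cos (real (Suc n) * t) = sin ((real (Suc n) + 1/2) * t) - sin ((real n + 1/2) * t)"
    unfolding 1 2 sin_add sin_diff by simp
  with Suc show ?case by (simp add: distrib_left)
qed simp

text \<open>At \<open>pi\<close> the partial sums and the limit are both zero. The mean value
  inequality carries this to \<open>t\<close>, after a correction of order 1/n has made the
  derivative of the error itself of order 1/n.\<close>

lemma sawtooth_sums: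
  assumes t: "t \<in> {0<..<2*pi}"
  shows "(\<lambda>k. sin (real (Suc k) * t) / real (Suc k)) sums ((pi - t) / 2)"
proof -
  \<comment> \<open>The segment joining \<open>t\<close> to \<open>pi\<close>, along which the mean
    value inequality will be applied.\<close>
  define S where "S = {min t pi..max t pi}"
  have S: "compact S" "S \<subseteq> {0<..<2*pi}" "t \<in> S" "pi \<in> S" "convex S" using t by (auto simp: S_def)
  obtain \<delta> where \<delta>: "\<delta> > 0" "\<And>s. s \<in> S \<Longrightarrow> 2 * sin (s/2) \<ge> \<delta>"
    using sin_half_bounded_below[OF S(1,2)] by blast
  \<comment> \<open>\<open>G n\<close> is an antiderivative of half the Dirichlet kernel; \<open>- H n\<close> is the boundary term after one
    partial integration, so that the remainder \<open>K n\<close> is of order \<open>1/n\<close>.\<close>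
  define G where "G n s = (\<Sum>k<n. sin (real (Suc k) * s) / real (Suc k)) - (pi - s)/2" for n s
  define H where "H n s = cos ((real n + 1/2) * s) / ((2 * real n + 1) * sin (s/2))" for n s
  define K where "K n s = cos ((real n + 1/2) * s) * cos (s/2) / (2 * (2 * real n + 1) * (sin (s/2))\<^sup>2)" for n s
  have deriv: "((\<lambda>s. G n s + H n s) has_real_derivative - K n s) (at s)" if s: "s \<in> S" for n s
  proof -
    have s0: "sin (s/2) > 0" using S(2) s by (intro sin_gt_zero) auto
    have "(\<Sum>k<n. cos (real (Suc k) * s)) + 1/2 = sin ((real n + 1/2) * s) / (2 * sin (s/2))"
      using sum_cos_multiples[of s n] s0 by (simp add: field_simps)
    moreover have "(G n has_real_derivative (\<Sum>k<n. cos (real (Suc k) * s)) + 1/2) (at s)"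
      unfolding G_def
      by (rule derivative_eq_intros DERIV_sum refl | simp del: of_nat_Suc)+
    moreover have "(H n has_real_derivative - sin ((real n + 1/2) * s) / (2 * sin (s/2)) - K n s) (at s)"
      unfolding H_def K_def using s0
      apply (auto intro!: derivative_eq_intros simp: add_pos_pos[THEN less_imp_neq, symmetric])
      apply (simp add: divide_simps add_pos_pos[THEN less_imp_neq, symmetric])
      apply (simp add: algebra_simps power2_eq_square)
      done
    ultimately show ?thesis
      by (auto intro!: derivative_eq_intros)
  qed
  have sm: "\<bar>u * v\<bar> \<le> 1" if "\<bar>u\<bar> \<le> 1" "\<bar>v\<bar> \<le> 1" for u v :: real
    using that by (simp add: abs_mult mult_le_one)
  have Kb: "\<bar>K n s\<bar> \<le> (2 / \<delta>\<^sup>2) / (2 * real n + 1)" if s: "s \<in> S" for n s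
  proof -
    have "\<bar>K n s\<bar> = \<bar>cos ((real n + 1/2) * s) * cos (s/2)\<bar> / (2 * (2 * real n + 1) * (sin (s/2))\<^sup>2)"
      unfolding K_def by (simp add: abs_mult)
    also have "\<dots> \<le> 1 / (2 * (2 * real n + 1) * (\<delta>/2)\<^sup>2)"
      using \<delta> \<delta>(2)[OF s]
      by (intro frac_le sm mult_left_mono power_mono) (auto intro!: mult_pos_pos)
    also have "\<dots> = (2 / \<delta>\<^sup>2) / (2 * real n + 1)"
      using \<delta>(1) by (simp add: power_divide frac_eq_eq)
    finally show ?thesis .
  qed
  have Hb: "\<bar>H n t\<bar> \<le> (2 / \<delta>) / (2 * real n + 1)" for n
  proof -
    have "\<bar>H n t\<bar> = \<bar>cos ((real n + 1/2) * t)\<bar> / ((2 * real n + 1) * sin (t/2))"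
      unfolding H_def using \<delta>(1) \<delta>(2)[OF S(3)] by (simp add: abs_mult)
    also have "\<dots> \<le> 1 / ((2 * real n + 1) * (\<delta>/2))"
      using \<delta>(1) \<delta>(2)[OF S(3)] by (intro frac_le mult_left_mono) (auto intro!: mult_pos_pos)
    finally show ?thesis by (simp add: field_simps)
  qed
  have zero: "G n pi + H n pi = 0" for n
  proof -
    have "sin (real (Suc k) * pi) = 0" for k using sin_npi[of "Suc k"] by simp
    moreover have "cos ((real n + 1/2) * pi) = 0"
      using sin_npi[of n] by (simp add: distrib_right cos_add)
    ultimately show ?thesis by (simp add: G_def H_def del: of_nat_Suc)
  qed
  define c where "c = 2 / \<delta>\<^sup>2 * \<bar>t - pi\<bar> + 2 / \<delta>"
  have bound: "\<bar>G n t\<bar> \<le> c / (2 * real n + 1)" for n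
  proof -
    have "norm ((G n t + H n t) - (G n pi + H n pi)) \<le> (2 / \<delta>\<^sup>2) / (2 * real n + 1) * norm (t - pi)"
      using S Kb deriv
      by (intro field_differentiable_bound[where S = S and f' = "\<lambda>s. - K n s"])
        (auto intro: has_field_derivative_at_within)
    then have "\<bar>G n t + H n t\<bar> \<le> (2 / \<delta>\<^sup>2) / (2 * real n + 1) * \<bar>t - pi\<bar>"
      unfolding zero by simp
    moreover have "c / (2 * real n + 1) = (2 / \<delta>\<^sup>2) / (2 * real n + 1) * \<bar>t - pi\<bar> + (2 / \<delta>) / (2 * real n + 1)"
      by (simp add: c_def add_divide_distrib)
    ultimately show ?thesis using Hb[of n] by linarith
  qed
  have "filterlim (\<lambda>n. 2 * real n + 1) at_top sequentially"
    by (intro filterlim_at_top_mono[OF filterlim_real_sequentially]) auto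
  then have "(\<lambda>n. c / (2 * real n + 1)) \<longlonglongrightarrow> 0"
    by (intro tendsto_divide_0[OF tendsto_const] filterlim_at_top_imp_at_infinity)
  then have "(\<lambda>n. G n t) \<longlonglongrightarrow> 0"
    by (rule Lim_null_comparison[rotated]) (use bound in \<open>auto\<close>)
  then have "(\<lambda>n. G n t + (pi - t)/2) \<longlonglongrightarrow> 0 + (pi - t)/2"
    by (intro tendsto_add tendsto_const)
  then show ?thesis by (simp add: G_def sums_def)
qed

subsection \<open>Bernoulli polynomials and their Fourier series\<close>

text \<open>Up to the sign \<open>(-1) ^ j\<close>, this is the \<open>j\<close>-th forward
  difference of the power x^m at \<open>t\<close>.\<close>

definition alt_sum :: "nat \<Rightarrow> nat \<Rightarrow> real \<Rightarrow> real" where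
  "alt_sum m j t = (\<Sum>k=0..j. (-1) ^ k * real (j choose k) * (t + real k) ^ m)"

lemma bernoulli_poly_alt_sum:
  "bernoulli_poly m t = (\<Sum>j=0..m. 1 / (real j + 1) * alt_sum m j t)"
  by (simp add: bernoulli_poly_def alt_sum_def)

text \<open>Split one factor t + k off the power; the part with k is absorbed by k binom(j+1,k) =
  (j+1) (binom(j+1,k) - binom(j,k)).\<close>

lemma alt_sum_Suc:
  "alt_sum (Suc m) (Suc j) t =
    t * alt_sum m (Suc j) t + real (Suc j) * (alt_sum m (Suc j) t - alt_sum m j t)"
proof -
  have absorb: "real k * real (Suc j choose k) = real (Suc j) * (real (Suc j choose k) - real (j choose k))"
    if "k \<le> Suc j" for k
  proof -
    have "(Suc j - k) * (Suc j choose k) = Suc j * (j choose k)"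
      using binomial_absorb_comp[of "Suc j" k] by simp
    then have "real (Suc j - k) * real (Suc j choose k) = real (Suc j) * real (j choose k)"
      by (metis of_nat_mult)
    then show ?thesis using that by (simp add: of_nat_diff algebra_simps)
  qed
  have low: "alt_sum m j t = (\<Sum>k=0..Suc j. (-1) ^ k * real (j choose k) * (t + real k) ^ m)"
    by (simp add: alt_sum_def)
  have "alt_sum (Suc m) (Suc j) t = (\<Sum>k=0..Suc j. t * ((-1) ^ k * real (Suc j choose k) * (t + real k) ^ m)
      + (-1) ^ k * (real k * real (Suc j choose k)) * (t + real k) ^ m)"
    unfolding alt_sum_def by (intro sum.cong refl) (simp add: algebra_simps)
  also have "\<dots> = (\<Sum>k=0..Suc j. t * ((-1) ^ k * real (Suc j choose k) * (t + real k) ^ m)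
      + real (Suc j) * ((-1) ^ k * real (Suc j choose k) * (t + real k) ^ m
          - (-1) ^ k * real (j choose k) * (t + real k) ^ m))"
  proof (intro sum.cong refl)
    fix k assume "k \<in> {0..Suc j}"
    then have "k \<le> Suc j" by simp
    note absorb = absorb[OF this]
    show "t * ((-1) ^ k * real (Suc j choose k) * (t + real k) ^ m)
        + (-1) ^ k * (real k * real (Suc j choose k)) * (t + real k) ^ m
        = t * ((-1) ^ k * real (Suc j choose k) * (t + real k) ^ m)
        + real (Suc j) * ((-1) ^ k * real (Suc j choose k) * (t + real k) ^ m
          - (-1) ^ k * real (j choose k) * (t + real k) ^ m)"
      unfolding absorb by (simp only: algebra_simps)
  qed
  also have "\<dots> = t * alt_sum m (Suc j) t + real (Suc j) * (alt_sum m (Suc j) t - alt_sum m j t)"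
    unfolding low unfolding alt_sum_def
    by (simp only: sum.distrib sum_subtractf[symmetric] sum_distrib_left)
  finally show ?thesis .
qed

text \<open>Differences of order above the degree vanish, so summands with \<open>j > m\<close> may
  be added to the sum for \<open>bernoulli_poly m\<close> freely.\<close>

lemma alt_sum_eq_0: "m < j \<Longrightarrow> alt_sum m j t = 0"
proof (induction m arbitrary: j)
  case 0
  then show ?case
    using choose_alternating_sum[of j, where 'a = real] by (simp add: alt_sum_def atLeast0AtMost)
next
  case (Suc m)
  then obtain i where "j = Suc i" "m < i" by (metis Suc_less_eq2)
  then show ?case using Suc.IH by (simp add: alt_sum_Suc)
qed

text \<open>Pascal's rule, after the index shift that turns \<open>t + real (Suc k)\<close> into
  \<open>t + 1 + real k\<close>.\<close>

lemma alt_sum_shift: "alt_sum m j (t + 1) - alt_sum m j t = - alt_sum m (Suc j) t"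
proof -
  let ?u = "\<lambda>k. (-1) ^ k * real (j choose k) * (t + real k) ^ m"
  have "alt_sum m (Suc j) t = t ^ m - (\<Sum>k=0..j. (-1) ^ k * real (Suc j choose Suc k) * (t + 1 + real k) ^ m)"
    by (simp add: alt_sum_def sum.atLeast0_atMost_Suc_shift sum_negf[symmetric] add_ac del: sum.cl_ivl_Suc binomial_Suc_Suc)
  also have "\<dots> = (t ^ m + (\<Sum>k=0..j. ?u (Suc k))) - alt_sum m j (t + 1)"
    by (simp add: alt_sum_def algebra_simps sum.distrib sum_negf)
  also have "t ^ m + (\<Sum>k=0..j. ?u (Suc k)) = (\<Sum>k=0..Suc j. ?u k)"
    by (simp add: sum.atLeast0_atMost_Suc_shift del: sum.cl_ivl_Suc)
  also have "\<dots> = alt_sum m j t" by (simp add: alt_sum_def)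
  finally show ?thesis by simp
qed

lemma bernoulli_poly_has_derivative:
  "(bernoulli_poly (Suc m) has_real_derivative real (Suc m) * bernoulli_poly m t) (at t)"
proof -
  have "(alt_sum (Suc m) j has_real_derivative real (Suc m) * alt_sum m j t) (at t)" for j
    unfolding alt_sum_def[abs_def] sum_distrib_left
    by (rule derivative_eq_intros DERIV_sum refl | simp del: of_nat_Suc)+
  then have "(bernoulli_poly (Suc m) has_real_derivative
      (\<Sum>j=0..Suc m. 1 / (real j + 1) * (real (Suc m) * alt_sum m j t))) (at t)"
    unfolding bernoulli_poly_alt_sum[abs_def]
    by (intro DERIV_sum DERIV_cmult)
  \<comment> \<open>The sum runs one index beyond that of \<open>bernoulli_poly m\<close>; the extra
    summand is a difference of too high order.\<close>
  moreover have "(\<Sum>j=0..Suc m. 1 / (real j + 1) * (real (Suc m) * alt_sum m j t))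
      = real (Suc m) * bernoulli_poly m t"
    by (simp add: bernoulli_poly_alt_sum alt_sum_eq_0 sum_distrib_left mult_ac del: of_nat_Suc)
  ultimately show ?thesis by simp
qed

text \<open>By the recurrence at \<open>t = 0\<close> the factor j+1 cancels the weight 1/(j+1), and
  the sum telescopes. The end term \<open>alt_sum m 0 0\<close> is 0^m, which vanishes because
  \<open>m >= 1\<close>; for B_1 the two values differ by one.\<close>

lemma bernoulli_poly_1_eq_0:
  assumes "m \<ge> 1"
  shows "bernoulli_poly (Suc m) 1 = bernoulli_poly (Suc m) 0"
proof -
  have "alt_sum (Suc m) j 1 - alt_sum (Suc m) j 0 = - (real (Suc j) * (alt_sum m (Suc j) 0 - alt_sum m j 0))" for j
    using alt_sum_shift[of "Suc m" j 0] alt_sum_Suc[of m j 0] by simp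
  then have "1 / (real j + 1) * (alt_sum (Suc m) j 1 - alt_sum (Suc m) j 0) = alt_sum m j 0 - alt_sum m (Suc j) 0" for j
    by (simp add: field_simps)
  then have "bernoulli_poly (Suc m) 1 - bernoulli_poly (Suc m) 0 =
      (\<Sum>j=0..Suc m. alt_sum m j 0 - alt_sum m (Suc j) 0)"
    unfolding bernoulli_poly_alt_sum
    by (simp only: sum_subtractf[symmetric] right_diff_distrib[symmetric])
  also have "\<dots> = alt_sum m 0 0 - alt_sum m (Suc (Suc m)) 0"
    by (rule sum_telescope[of "\<lambda>j. alt_sum m j 0" "Suc m", unfolded atMost_atLeast0])
  also have "\<dots> = 0" using assms by (simp add: alt_sum_eq_0) (simp add: alt_sum_def)
  finally show ?thesis by simp
qed

text \<open>Scaling to length \<open>2*pi\<close> and dividing by \<open>fact m\<close> makes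
  differentiation lower the index with no factor. These are the coefficients of the powers of
  \<open>A\<close> in \<open>poly_part\<close>.\<close>

definition scaled_bernoulli :: "nat \<Rightarrow> real \<Rightarrow> real" where
  "scaled_bernoulli m t = (2*pi) ^ m / fact m * bernoulli_poly m (t / (2*pi))"

lemma scaled_bernoulli_0: "scaled_bernoulli 0 t = 1"
  by (simp add: scaled_bernoulli_def bernoulli_poly_def)

lemma scaled_bernoulli_1: "scaled_bernoulli 1 t = t - pi"
  by (simp add: scaled_bernoulli_def bernoulli_poly_def field_simps)

lemma scaled_bernoulli_has_derivative:
  "(scaled_bernoulli (Suc m) has_real_derivative scaled_bernoulli m t) (at t)"
proof -
  have "((\<lambda>t. bernoulli_poly (Suc m) (t / (2*pi))) has_real_derivative
      real (Suc m) * bernoulli_poly m (t / (2*pi)) * (1 / (2*pi))) (at t)"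
    by (rule DERIV_chain'[OF _ bernoulli_poly_has_derivative])
      (auto intro!: derivative_eq_intros)
  from DERIV_cmult[OF this, of "(2*pi) ^ Suc m / fact (Suc m)"]
  have "(scaled_bernoulli (Suc m) has_real_derivative (2*pi) ^ Suc m / fact (Suc m) *
      (real (Suc m) * bernoulli_poly m (t / (2*pi)) * (1 / (2*pi)))) (at t)"
    by (simp only: scaled_bernoulli_def[abs_def])
  moreover have "(2*pi) ^ Suc m / fact (Suc m) * (real (Suc m) * bernoulli_poly m (t / (2*pi)) * (1 / (2*pi)))
      = scaled_bernoulli m t"
    by (simp add: scaled_bernoulli_def del: of_nat_Suc)
  ultimately show ?thesis by simp
qed

lemma continuous_on_scaled_bernoulli: "continuous_on S (scaled_bernoulli m)"
proof (cases m)
  case 0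
  then show ?thesis by (simp add: scaled_bernoulli_0[abs_def])
next
  case (Suc l)
  then show ?thesis
    using scaled_bernoulli_has_derivative
    by (auto intro: continuous_at_imp_continuous_on DERIV_isCont)
qed

lemma scaled_bernoulli_has_integral:
  assumes "m \<ge> 1"
  shows "(scaled_bernoulli m has_integral 0) {0..2*pi}"
proof -
  have "(scaled_bernoulli m has_integral scaled_bernoulli (Suc m) (2*pi) - scaled_bernoulli (Suc m) 0) {0..2*pi}"
    using scaled_bernoulli_has_derivative
    by (intro fundamental_theorem_of_calculus)
      (auto simp: has_real_derivative_iff_has_vector_derivative[symmetric] intro: has_field_derivative_at_within)
  then show ?thesis using bernoulli_poly_1_eq_0[OF assms] by (simp add: scaled_bernoulli_def)
qed

section \<open>Fourier series of Bernoulli polynomials\<close>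

lemma has_integral_cos_multiple:
  "((\<lambda>t. cos (real (Suc k) * t - \<phi>)) has_integral 0) {0..2*pi}"
proof -
  have "((\<lambda>t. cos (real (Suc k) * t - \<phi>)) has_integral
      sin (real (Suc k) * (2*pi) - \<phi>) / real (Suc k) - sin (real (Suc k) * 0 - \<phi>) / real (Suc k)) {0..2*pi}"
    by (intro fundamental_theorem_of_calculus)
      (auto simp: has_real_derivative_iff_has_vector_derivative[symmetric] simp del: of_nat_Suc
        intro!: derivative_eq_intros)
  moreover have "sin (real (Suc k) * (2*pi) - \<phi>) = sin (- \<phi>)"
    using sin_2npi[of "Suc k"] cos_2npi[of "Suc k"] unfolding sin_diff
    by (simp add: mult_ac del: of_nat_Suc)
  ultimately show ?thesis by (simp del: of_nat_Suc)
qed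

lemma inverse_power_bounded_variation:
  assumes "m \<ge> 1"
  shows "(\<lambda>k. 1 / real (Suc k) ^ m) \<longlonglongrightarrow> 0"
    and "summable (\<lambda>k. norm (1 / real (Suc k) ^ m - 1 / real (Suc (Suc k)) ^ m))"
proof -
  have "(\<lambda>k. (1 / real (Suc k)) ^ m) \<longlonglongrightarrow> 0 ^ m"
    using LIMSEQ_inverse_real_of_nat by (intro tendsto_power) (simp add: inverse_eq_divide)
  then show lim: "(\<lambda>k. 1 / real (Suc k) ^ m) \<longlonglongrightarrow> 0"
    using assms by (simp add: power_divide zero_power)
  have "norm (1 / real (Suc k) ^ m - 1 / real (Suc (Suc k)) ^ m) = 1 / real (Suc k) ^ m - 1 / real (Suc (Suc k)) ^ m" for k
    unfolding real_norm_def by (intro abs_of_nonneg) (simp add: frac_le power_mono)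
  then show "summable (\<lambda>k. norm (1 / real (Suc k) ^ m - 1 / real (Suc (Suc k)) ^ m))"
    using telescope_summable'[OF lim] by simp
qed

lemma summable_inverse_power_Suc:
  assumes "m \<ge> 2" shows "summable (\<lambda>k. 1 / real (Suc k) ^ m)"
  using inverse_power_summable[OF assms, where 'a = real]
  by (subst (asm) summable_Suc_iff[symmetric]) (simp add: inverse_eq_divide)

lemma uniform_limit_series_integral:
  fixes f :: "nat \<Rightarrow> real \<Rightarrow> 'a::banach"
  assumes "uniform_limit {a..b} (\<lambda>n t. \<Sum>k<n. f k t) F sequentially"
    and "\<And>k. continuous_on {a..b} (f k)" and int: "\<And>k. (f k has_integral 0) {a..b}"
  shows "(F has_integral 0) {a..b}"
proof -
  obtain I J where *: "\<And>n. ((\<lambda>t. \<Sum>k<n. f k t) has_integral I n) {a..b}"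
      "(F has_integral J) {a..b}" "I \<longlonglongrightarrow> J"
    by (rule uniform_limit_integral[OF assms(1)]) (auto intro!: continuous_on_sum assms(2))
  have "((\<lambda>t. \<Sum>k<n. f k t) has_integral 0) {a..b}" for n
    using has_integral_sum[of "{..<n}" f "\<lambda>_. 0"] int by simp
  then have "I n = 0" for n using *(1) has_integral_unique by blast
  then have "I = (\<lambda>_. 0)" by blast
  then have "J = 0" using *(3) by (simp add: LIMSEQ_const_iff)
  then show ?thesis using *(2) by simp
qed

text \<open>Each phase shift by \<open>pi/2\<close> is one termwise integration. The derivatives
  agree inside the interval, so by continuity the two sides differ by a constant up to the
  endpoints, and both have mean zero. Assuming only the open interval lets the induction start from
  the sawtooth series, whose formula fails at the endpoints.\<close>

lemma fourier_bernoulli_step: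
  assumes m: "m \<ge> 1"
    and sums: "\<And>t. t \<in> {0<..<2*pi} \<Longrightarrow>
      (\<lambda>k. cos (real (Suc k) * t - real m * pi / 2) / real (Suc k) ^ m) sums (- scaled_bernoulli m t / 2)"
    and t: "t \<in> {0..2*pi}"
  shows "(\<lambda>k. cos (real (Suc k) * t - real (Suc m) * pi / 2) / real (Suc k) ^ Suc m)
    sums (- scaled_bernoulli (Suc m) t / 2)"
proof -
  define \<phi> where "\<phi> = real m * pi / 2"
  define f where "f k t = cos (real (Suc k) * t - (\<phi> + pi/2)) / real (Suc k) ^ Suc m" for k t
  define g where "g k t = cos (real (Suc k) * t - \<phi>) / real (Suc k) ^ m" for k t
  define F where "F t = (\<Sum>k. f k t)" for t
  have cosf: "cos (x - (\<phi> + pi/2)) = sin (x - \<phi>)" for x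
    using cos_diff[of "x - \<phi>" "pi/2"] by (simp add: algebra_simps)
  have bound: "norm (f k t) \<le> 1 / real (Suc k) ^ Suc m" for k t
    by (simp add: f_def abs_mult divide_right_mono del: of_nat_Suc)
  have smbl: "summable (\<lambda>k. 1 / real (Suc k) ^ Suc m)"
    using m by (intro summable_inverse_power_Suc) auto
  have ul: "uniform_limit UNIV (\<lambda>n t. \<Sum>k<n. f k t) F sequentially"
    unfolding F_def by (rule Weierstrass_m_test[OF bound smbl])
  have Fsums: "(\<lambda>k. f k s) sums F s" for s
    using tendsto_uniform_limitI[OF ul, of s] by (simp add: sums_def)
  have contf: "continuous_on S (f k)" for S k
    unfolding f_def[abs_def] by (intro continuous_intros) auto
  have contF: "continuous_on {0..2*pi} F"
    by (rule uniform_limit_theorem[OF _ uniform_limit_on_subset[OF ul]])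
      (auto intro!: always_eventually continuous_on_sum contf)
  have intF: "(F has_integral 0) {0..2*pi}"
  proof (rule uniform_limit_series_integral[OF uniform_limit_on_subset[OF ul]])
    show "(f k has_integral 0) {0..2*pi}" for k
      using has_integral_mult_left[OF has_integral_cos_multiple[of k "\<phi> + pi/2"], of "1 / real (Suc k) ^ Suc m"]
      by (simp add: f_def[abs_def])
  qed (auto intro: contf)
  obtain G where G: "\<And>t. t \<in> {0<..<2*pi} \<Longrightarrow> (F has_vector_derivative G t) (at t)"
      "\<And>t. t \<in> {0<..<2*pi} \<Longrightarrow> (\<lambda>n. g n t) sums G t"
  proof (rule series_has_vector_derivative[of f g 0 "2*pi" F])
    show "(f k has_vector_derivative g k t) (at t)" for k t
      unfolding f_def[abs_def] g_def cosf has_real_derivative_iff_has_vector_derivative[symmetric]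
      by (auto intro!: derivative_eq_intros simp del: of_nat_Suc)
    show "continuous_on UNIV (g k)" for k
      unfolding g_def[abs_def] by (intro continuous_intros) auto
    show "\<exists>G. uniform_limit S (\<lambda>n t. \<Sum>k<n. g k t) G sequentially"
      if "compact S" "S \<subseteq> {0<..<2*pi}" for S
      using trig_series_uniform[OF inverse_power_bounded_variation[OF m] that, of \<phi>]
      by (simp add: g_def)
  qed (auto intro: Fsums)
  have "G s = - scaled_bernoulli m s / 2" if "s \<in> {0<..<2*pi}" for s
    using sums_unique2[OF G(2)[OF that]] sums[OF that] by (simp add: g_def \<phi>_def)
  then have F': "((\<lambda>t. F t + scaled_bernoulli (Suc m) t / 2) has_vector_derivative 0) (at s)"
    if "s \<in> {0<..<2*pi}" for s
    using G(1)[OF that] that scaled_bernoulli_has_derivative[of m s]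
    unfolding has_real_derivative_iff_has_vector_derivative[symmetric]
    by (auto intro!: derivative_eq_intros)
  define c where "c = F 0 + scaled_bernoulli (Suc m) 0 / 2"
  have const: "F s + scaled_bernoulli (Suc m) s / 2 = c" if "s \<in> {0..2*pi}" for s
  proof -
    have "((\<lambda>_. 0) has_integral (F s + scaled_bernoulli (Suc m) s / 2 - c)) {0..s}"
      unfolding c_def using that
      by (intro fundamental_theorem_of_calculus_interior F' continuous_intros
          continuous_on_subset[OF contF] continuous_on_scaled_bernoulli) auto
    then show ?thesis using has_integral_unique has_integral_0 by force
  qed
  have "((\<lambda>s. F s + scaled_bernoulli (Suc m) s / 2) has_integral 0 + 0 / 2) {0..2*pi}"
    by (intro has_integral_add intF has_integral_divide scaled_bernoulli_has_integral) auto
  then have "((\<lambda>s. c) has_integral 0) {0..2*pi}"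
    using has_integral_cong[of "{0..2*pi}" "\<lambda>s. F s + scaled_bernoulli (Suc m) s / 2" "\<lambda>s. c" 0] const by simp
  then have "c = 0"
    using has_integral_unique[OF _ has_integral_const_real[of c 0 "2*pi"], of 0] by simp
  then have "F t = - scaled_bernoulli (Suc m) t / 2" using const[OF t] by simp
  then show ?thesis using Fsums[of t] by (simp add: f_def \<phi>_def algebra_simps add_divide_distrib)
qed

lemma fourier_bernoulli_interior:
  "t \<in> {0<..<2*pi} \<Longrightarrow>
    (\<lambda>k. cos (real (Suc k) * t - real (Suc m) * pi / 2) / real (Suc k) ^ Suc m)
      sums (- scaled_bernoulli (Suc m) t / 2)"
proof (induction m arbitrary: t)
  case 0
  then show ?case
    using sawtooth_sums[of t] scaled_bernoulli_1[of t] by (simp add: cos_diff)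
next
  case (Suc m)
  then show ?case by (intro fourier_bernoulli_step[OF _ Suc.IH]) auto
qed

lemma fourier_bernoulli:
  assumes "t \<in> {0..2*pi}" "m \<ge> 2"
  shows "(\<lambda>k. cos (real (Suc k) * t - real m * pi / 2) / real (Suc k) ^ m)
      sums (- scaled_bernoulli m t / 2)"
proof -
  obtain l where "m = Suc (Suc l)"
    using assms(2) by (metis add_2_eq_Suc le_Suc_ex)
  then show ?thesis
    using fourier_bernoulli_step[OF _ fourier_bernoulli_interior assms(1), of l] by simp
qed

text \<open>The phase amounts to n+1 half turns, hence the sign. The orders 2n+2 and, in the odd
  case, 2n+3 are those of the two terms by which \<open>poly_part\<close> grows from n to
  n+1.\<close>

lemma fourier_bernoulli_even:
  assumes "t \<in> {0..2*pi}"
  shows "(\<lambda>k. cos (real (Suc k) * t) / real (Suc k) ^ (2*n+2))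
      sums ((-1) ^ n * scaled_bernoulli (2*n+2) t / 2)"
proof -
  have "cos (x - real (2*n+2) * pi / 2) = (-1) ^ Suc n * cos x" for x
  proof -
    have "x - real (2*n+2) * pi / 2 = x - real (Suc n) * pi" by (simp add: field_simps)
    then show ?thesis by (simp add: cos_diff del: of_nat_Suc)
  qed
  then have "(\<lambda>k. (-1) ^ Suc n * (cos (real (Suc k) * t) / real (Suc k) ^ (2*n+2)))
      sums (- scaled_bernoulli (2*n+2) t / 2)"
    using fourier_bernoulli[OF assms, of "2*n+2"] by simp
  from sums_mult[OF this, of "(-1) ^ Suc n"] show ?thesis
    by (simp add: mult.assoc[symmetric] power_add[symmetric] mult_2[symmetric])
qed

lemma fourier_bernoulli_odd:
  assumes "t \<in> {0..2*pi}"
  shows "(\<lambda>k. sin (real (Suc k) * t) / real (Suc k) ^ (2*n+3))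
      sums ((-1) ^ n * scaled_bernoulli (2*n+3) t / 2)"
proof -
  have "cos (x - real (2*n+3) * pi / 2) = (-1) ^ Suc n * sin x" for x
  proof -
    have "x - real (2*n+3) * pi / 2 = (x - pi/2) - real (Suc n) * pi" by (simp add: field_simps)
    then show ?thesis by (simp only: cos_diff[of "x - pi/2"]) (simp add: cos_diff del: of_nat_Suc)
  qed
  then have "(\<lambda>k. (-1) ^ Suc n * (sin (real (Suc k) * t) / real (Suc k) ^ (2*n+3)))
      sums (- scaled_bernoulli (2*n+3) t / 2)"
    using fourier_bernoulli[OF assms, of "2*n+3"] by simp
  from sums_mult[OF this, of "(-1) ^ Suc n"] show ?thesis
    by (simp add: mult.assoc[symmetric] power_add[symmetric] mult_2[symmetric])
qed

subsection \<open>Functions with vanishing Fourier coefficients\<close>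

lemma scaled_bernoulli_2: "scaled_bernoulli 2 x = x\<^sup>2 / 2 - pi * x + pi\<^sup>2 / 3"
  by (simp add: scaled_bernoulli_def bernoulli_poly_def numeral_2_eq_2 field_simps)

text \<open>
  Pairing \<open>u\<close> with the periodic kernel \<open>\<Sum> cos(k(t - s))/k\<^sup>2\<close>, which is quadratic in \<open>|t - s|\<close>, shows that
  \<open>\<integral> |t - s| u(t) dt\<close> is affine in \<open>s\<close>; its second derivative is \<open>2 u(s)\<close>.
\<close>

lemma zero_if_fourier_coefficients_zero:
  fixes u :: "real \<Rightarrow> 'a::banach"
  assumes cont: "continuous_on {0..2*pi} u"
    and mean: "(u has_integral 0) {0..2*pi}"
    and coeff_cos: "\<And>k. ((\<lambda>t. cos (real (Suc k) * t) *\<^sub>R u t) has_integral 0) {0..2*pi}"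
    and coeff_sin: "\<And>k. ((\<lambda>t. sin (real (Suc k) * t) *\<^sub>R u t) has_integral 0) {0..2*pi}"
    and s: "s \<in> {0..2*pi}"
  shows "u s = 0"
proof -
  \<comment> \<open>Moments over the whole interval, then running integrals: together they express
    any integral of \<open>u\<close> against a kernel quadratic on each side of
    \<open>s\<close>.\<close>
  define m1 where "m1 = integral {0..2*pi} (\<lambda>t. t *\<^sub>R u t)"
  define m2 where "m2 = integral {0..2*pi} (\<lambda>t. t\<^sup>2 *\<^sub>R u t)"
  define U where "U s = integral {0..s} u" for s
  define W where "W s = integral {0..s} (\<lambda>t. t *\<^sub>R u t)" for s
  have int1: "(\<lambda>t. t *\<^sub>R u t) integrable_on {0..2*pi}" and int2: "(\<lambda>t. t\<^sup>2 *\<^sub>R u t) integrable_on {0..2*pi}"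
    by (intro integrable_continuous_real continuous_intros cont)+
  have ids: "2 *\<^sub>R (s *\<^sub>R U s - W s) + m1 + (s / pi) *\<^sub>R m1 - (1 / (2*pi)) *\<^sub>R m2 = 0"
    if s: "s \<in> {0..2*pi}" for s
  proof -
    obtain B where B: "\<And>t. t \<in> {0..2*pi} \<Longrightarrow> norm (u t) \<le> B"
      using compact_imp_bounded[OF compact_continuous_image[OF cont]] unfolding bounded_iff
      by (metis compact_Icc imageI)
    define f where "f k t = (cos (real (Suc k) * (t - s)) / real (Suc k) ^ 2) *\<^sub>R u t" for k t
    have "((\<lambda>t. \<Sum>k. f k t) has_integral 0) {0..2*pi}"
    proof (rule uniform_limit_series_integral)
      show "uniform_limit {0..2*pi} (\<lambda>n t. \<Sum>k<n. f k t) (\<lambda>t. \<Sum>k. f k t) sequentially"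
      proof (rule Weierstrass_m_test)
        show "summable (\<lambda>k. 1 / real (Suc k) ^ 2 * B)"
          by (intro summable_mult2 summable_inverse_power_Suc) simp
        fix k t assume t: "t \<in> {0..2*pi}"
        have "norm (f k t) = \<bar>cos (real (Suc k) * (t - s))\<bar> / real (Suc k) ^ 2 * norm (u t)"
          by (simp add: f_def del: of_nat_Suc)
        also have "\<dots> \<le> 1 / real (Suc k) ^ 2 * B"
          using B[OF t] by (intro mult_mono divide_right_mono) auto
        finally show "norm (f k t) \<le> 1 / real (Suc k) ^ 2 * B" .
      qed
      show "continuous_on {0..2*pi} (f k)" for k
        unfolding f_def[abs_def] by (intro continuous_intros cont) auto
      show "(f k has_integral 0) {0..2*pi}" for k
      proof -
        have "((\<lambda>t. (cos (real (Suc k) * s) / real (Suc k) ^ 2) *\<^sub>R (cos (real (Suc k) * t) *\<^sub>R u t)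
            + (sin (real (Suc k) * s) / real (Suc k) ^ 2) *\<^sub>R (sin (real (Suc k) * t) *\<^sub>R u t))
            has_integral (cos (real (Suc k) * s) / real (Suc k) ^ 2) *\<^sub>R 0
              + (sin (real (Suc k) * s) / real (Suc k) ^ 2) *\<^sub>R 0) {0..2*pi}"
          by (intro has_integral_add has_integral_cmul coeff_cos coeff_sin)
        moreover have "f k = (\<lambda>t. (cos (real (Suc k) * s) / real (Suc k) ^ 2) *\<^sub>R (cos (real (Suc k) * t) *\<^sub>R u t)
            + (sin (real (Suc k) * s) / real (Suc k) ^ 2) *\<^sub>R (sin (real (Suc k) * t) *\<^sub>R u t))"
        proof
          fix t
          have "cos (real (Suc k) * (t - s)) = cos (real (Suc k) * s) * cos (real (Suc k) * t)
              + sin (real (Suc k) * s) * sin (real (Suc k) * t)"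
            unfolding right_diff_distrib cos_diff by (simp only: mult.commute)
          then show "f k t = (cos (real (Suc k) * s) / real (Suc k) ^ 2) *\<^sub>R (cos (real (Suc k) * t) *\<^sub>R u t)
              + (sin (real (Suc k) * s) / real (Suc k) ^ 2) *\<^sub>R (sin (real (Suc k) * t) *\<^sub>R u t)"
            unfolding f_def by (simp add: scaleR_add_left[symmetric] add_divide_distrib)
        qed
        ultimately show ?thesis by simp
      qed
    qed
    moreover have "(\<Sum>k. f k t) = (scaled_bernoulli 2 \<bar>t - s\<bar> / 2) *\<^sub>R u t" if t: "t \<in> {0..2*pi}" for t
    proof -
      \<comment> \<open>The closed form of the series holds on \<open>{0..2*pi}\<close>, which
        contains the modulus of \<open>t - s\<close> but not always \<open>t - s\<close>; the cosine
        is even.\<close>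
      have range: "\<bar>t - s\<bar> \<in> {0..2*pi}" using s t by (auto simp: abs_if)
      have "cos (real (Suc k) * \<bar>t - s\<bar>) = cos (real (Suc k) * (t - s))" for k
        by (metis abs_mult abs_of_nat cos_abs_real)
      then have "(\<lambda>k. cos (real (Suc k) * (t - s)) / real (Suc k) ^ 2) sums (scaled_bernoulli 2 \<bar>t - s\<bar> / 2)"
        using fourier_bernoulli_even[OF range, of 0] by (simp add: numeral_2_eq_2)
      then have "(\<lambda>k. f k t) sums ((scaled_bernoulli 2 \<bar>t - s\<bar> / 2) *\<^sub>R u t)"
        unfolding f_def by (rule bounded_linear.sums[OF bounded_linear_scaleR_left])
      then show ?thesis by (simp add: sums_iff)
    qed
    ultimately have 1: "((\<lambda>t. (scaled_bernoulli 2 \<bar>t - s\<bar> / 2) *\<^sub>R u t) has_integral 0) {0..2*pi}"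
      by (rule has_integral_eq[rotated]) simp
    have U2: "(u has_integral - U s) {s..2*pi}"
    proof -
      have "(u has_integral U s) {0..s}"
        unfolding U_def using s
        by (intro integrable_integral integrable_continuous_real continuous_on_subset[OF cont]) auto
      moreover obtain j where j: "(u has_integral j) {s..2*pi}"
        using integrable_continuous_real[OF continuous_on_subset[OF cont, of "{s..2*pi}"]] s by (auto simp: integrable_on_def)
      ultimately have "(u has_integral U s + j) {0..2*pi}"
        using s by (intro has_integral_combine[of 0 s]) auto
      then have "U s + j = 0" using mean has_integral_unique by blast
      then have "j = - U s" by (simp add: eq_neg_iff_add_eq_0 add.commute)
      then show ?thesis using j by simp
    qed
    have U1: "(u has_integral U s) {0..s}"
      unfolding U_def using s
      by (intro integrable_integral integrable_continuous_real continuous_on_subset[OF cont]) auto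
    have W1: "((\<lambda>t. t *\<^sub>R u t) has_integral W s) {0..s}"
      unfolding W_def using s
      by (intro integrable_integral integrable_continuous_real continuous_intros continuous_on_subset[OF cont]) auto
    have W2: "((\<lambda>t. t *\<^sub>R u t) has_integral m1 - W s) {s..2*pi}"
    proof -
      have "continuous_on {s..2*pi} (\<lambda>t. t *\<^sub>R u t)"
        using s by (intro continuous_intros continuous_on_subset[OF cont]) auto
      then obtain j where j: "((\<lambda>t. t *\<^sub>R u t) has_integral j) {s..2*pi}"
        using integrable_continuous_real unfolding integrable_on_def by blast
      then have "((\<lambda>t. t *\<^sub>R u t) has_integral W s + j) {0..2*pi}"
        using s W1 by (intro has_integral_combine[of 0 s]) auto
      then have "m1 = W s + j" unfolding m1_def by (simp add: integral_unique)
      then show ?thesis using j by simp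
    qed
    have "((\<lambda>t. \<bar>t - s\<bar> *\<^sub>R u t) has_integral s *\<^sub>R U s - W s) {0..s}"
      by (rule has_integral_eq[OF _ has_integral_diff[OF has_integral_cmul[OF U1, of s] W1]])
        (simp add: scaleR_diff_left[symmetric])
    moreover have "((\<lambda>t. \<bar>t - s\<bar> *\<^sub>R u t) has_integral (m1 - W s) - s *\<^sub>R (- U s)) {s..2*pi}"
      by (rule has_integral_eq[OF _ has_integral_diff[OF W2 has_integral_cmul[OF U2, of s]]])
        (simp add: scaleR_diff_left[symmetric])
    ultimately have abs: "((\<lambda>t. \<bar>t - s\<bar> *\<^sub>R u t) has_integral
        (s *\<^sub>R U s - W s) + ((m1 - W s) - s *\<^sub>R (- U s))) {0..2*pi}"
      using s by (intro has_integral_combine[of 0 s]) auto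
    have "((\<lambda>t. (1/4) *\<^sub>R (t\<^sup>2 *\<^sub>R u t) - (s / 2) *\<^sub>R (t *\<^sub>R u t)
          + (s\<^sup>2 / 4 + pi\<^sup>2 / 6) *\<^sub>R u t - (pi / 2) *\<^sub>R (\<bar>t - s\<bar> *\<^sub>R u t))
        has_integral (1/4) *\<^sub>R m2 - (s / 2) *\<^sub>R m1 + (s\<^sup>2 / 4 + pi\<^sup>2 / 6) *\<^sub>R 0
          - (pi / 2) *\<^sub>R ((s *\<^sub>R U s - W s) + ((m1 - W s) - s *\<^sub>R (- U s)))) {0..2*pi}"
      unfolding m1_def m2_def using abs unfolding m1_def
      by (intro has_integral_add has_integral_diff has_integral_cmul mean integrable_integral int1 int2) auto
    moreover have "(\<lambda>t. (1/4) *\<^sub>R (t\<^sup>2 *\<^sub>R u t) - (s / 2) *\<^sub>R (t *\<^sub>R u t)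
          + (s\<^sup>2 / 4 + pi\<^sup>2 / 6) *\<^sub>R u t - (pi / 2) *\<^sub>R (\<bar>t - s\<bar> *\<^sub>R u t))
        = (\<lambda>t. (scaled_bernoulli 2 \<bar>t - s\<bar> / 2) *\<^sub>R u t)"
    proof
      fix t
      have "(1/4) * t\<^sup>2 - (s / 2) * t + (s\<^sup>2 / 4 + pi\<^sup>2 / 6) - (pi / 2) * \<bar>t - s\<bar>
          = scaled_bernoulli 2 \<bar>t - s\<bar> / 2"
        unfolding scaled_bernoulli_2 power2_abs by (simp add: power2_diff field_simps)
      then show "(1/4) *\<^sub>R (t\<^sup>2 *\<^sub>R u t) - (s / 2) *\<^sub>R (t *\<^sub>R u t)
          + (s\<^sup>2 / 4 + pi\<^sup>2 / 6) *\<^sub>R u t - (pi / 2) *\<^sub>R (\<bar>t - s\<bar> *\<^sub>R u t)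
          = (scaled_bernoulli 2 \<bar>t - s\<bar> / 2) *\<^sub>R u t"
        by (simp only: scaleR_scaleR scaleR_add_left[symmetric] scaleR_diff_left[symmetric])
    qed
    ultimately have "((\<lambda>t. (scaled_bernoulli 2 \<bar>t - s\<bar> / 2) *\<^sub>R u t) has_integral
        (1/4) *\<^sub>R m2 - (s / 2) *\<^sub>R m1
          - (pi / 2) *\<^sub>R ((s *\<^sub>R U s - W s) + ((m1 - W s) - s *\<^sub>R (- U s)))) {0..2*pi}"
      by (simp only: scaleR_zero_right add_0_right)
    then have 2: "(1/4) *\<^sub>R m2 - (s / 2) *\<^sub>R m1
          - (pi / 2) *\<^sub>R ((s *\<^sub>R U s - W s) + ((m1 - W s) - s *\<^sub>R (- U s))) = 0"
      using 1 by (rule has_integral_unique)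
    \<comment> \<open>The factor -2/pi gives the integral of \<open>u\<close> against the modulus of
      \<open>t - s\<close> the coefficient one.\<close>
    have "2 *\<^sub>R (s *\<^sub>R U s - W s) + m1 + (s / pi) *\<^sub>R m1 - (1 / (2*pi)) *\<^sub>R m2
      = (- 2 / pi) *\<^sub>R ((1/4) *\<^sub>R m2 - (s / 2) *\<^sub>R m1
          - (pi / 2) *\<^sub>R ((s *\<^sub>R U s - W s) + ((m1 - W s) - s *\<^sub>R (- U s))))"
      by (simp add: scaleR_diff_right scaleR_add_right scaleR_2) (simp add: scaleR_add_left[symmetric])
    also note 2
    finally show ?thesis by simp
  qed
  have unique: "a = b" if "(f has_vector_derivative a) (at s within {0..2*pi})"
    "(f has_vector_derivative b) (at s within {0..2*pi})" "s \<in> {0..2*pi}" for f a s and b :: 'a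
    using vector_derivative_unique_within_closed_interval[of 0 "2*pi" s f a b] that by simp
  have dU: "(U has_vector_derivative u s) (at s within {0..2*pi})" if "s \<in> {0..2*pi}" for s
    unfolding U_def[abs_def] by (rule integral_has_vector_derivative[OF cont that])
  have dW: "(W has_vector_derivative s *\<^sub>R u s) (at s within {0..2*pi})" if "s \<in> {0..2*pi}" for s
    unfolding W_def[abs_def]
    by (rule integral_has_vector_derivative[OF _ that]) (intro continuous_intros cont)
  have zero: "((\<lambda>_. 0) has_vector_derivative (0::'a)) (at s within {0..2*pi})" for s
    by simp
  \<comment> \<open>In the derivative of \<open>s *\<^sub>R U s - W s\<close> the terms
    \<open>s *\<^sub>R u s\<close> cancel, so differentiating \<open>ids\<close> once shows that
    \<open>U\<close> is constant; differentiating again gives \<open>u s = 0\<close>. Derivatives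
    within the closed interval include the endpoints.\<close>
  have Us: "U s = (- 1 / (2*pi)) *\<^sub>R m1" if s: "s \<in> {0..2*pi}" for s
  proof -
    have "((\<lambda>s. 2 *\<^sub>R (s *\<^sub>R U s - W s) + m1 + (s / pi) *\<^sub>R m1 - (1 / (2*pi)) *\<^sub>R m2)
        has_vector_derivative 2 *\<^sub>R U s + (1 / pi) *\<^sub>R m1) (at s within {0..2*pi})"
      by (auto intro!: derivative_eq_intros dU dW s)
    then have "((\<lambda>s. 0) has_vector_derivative 2 *\<^sub>R U s + (1 / pi) *\<^sub>R m1) (at s within {0..2*pi})"
      using ids s by (elim has_vector_derivative_transform[rotated 2]) auto
    then have "2 *\<^sub>R U s + (1 / pi) *\<^sub>R m1 = 0"
      using zero s by (rule unique)
    then have "2 *\<^sub>R U s = - ((1 / pi) *\<^sub>R m1)" by (simp only: eq_neg_iff_add_eq_0)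
    then have "(1/2) *\<^sub>R (2 *\<^sub>R U s) = (1/2) *\<^sub>R (- ((1 / pi) *\<^sub>R m1))" by (simp only:)
    then show ?thesis by simp
  qed
  have "((\<lambda>s. (- 1 / (2*pi)) *\<^sub>R m1) has_vector_derivative u s) (at s within {0..2*pi})"
    using dU[OF s] Us s by (elim has_vector_derivative_transform[rotated 2]) auto
  moreover have "((\<lambda>s. (- 1 / (2*pi)) *\<^sub>R m1) has_vector_derivative 0) (at s within {0..2*pi})"
    by simp
  ultimately show ?thesis using s by (rule unique)
qed

lemma bounded_linear_scaleC_right: "bounded_linear (\<lambda>x::'a::complex_banach. c *\<^sub>C x)"
proof (rule bounded_linear_intro[of _ "cmod c"])
  show "c *\<^sub>C (r *\<^sub>R x) = r *\<^sub>R (c *\<^sub>C x)" for r and x :: 'a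
    by (simp only: scaleC_of_real[symmetric] scaleC_scaleC mult.commute)
qed (simp_all add: scaleC_add_right norm_scaleC mult.commute)

lemma power_domain_iff: "x \<in> power_domain D A m \<longleftrightarrow> (\<forall>j<m. (A ^^ j) x \<in> D)"
  by (induction m) (auto simp: less_Suc_eq)

lemma poly_part_eq: "poly_part A f n t = (\<Sum>k=0..2*n+1. scaled_bernoulli k t *\<^sub>R (A ^^ k) f)"
  by (simp add: poly_part_def scaled_bernoulli_def)

subsection \<open>Resolvents on the imaginary integers\<close>

locale integer_resolvent_bound =
  fixes D :: "'a::complex_banach set" and A :: "'a \<Rightarrow> 'a" and C :: real
  assumes closed_op: "closed_linear_operator D A"
    and regular: "\<And>k::int. k \<noteq> 0 \<Longrightarrow> regular_point D A (\<i> * of_int k)"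
    and onorm_resolvent:
      "\<And>k::int. k \<noteq> 0 \<Longrightarrow> onorm (resolvent D A (\<i> * of_int k)) \<le> C / \<bar>real_of_int k\<bar>"
    and C_pos: "C > 0"
begin

lemma
  shows A_add: "x \<in> D \<Longrightarrow> y \<in> D \<Longrightarrow> A (x + y) = A x + A y"
    and A_scaleC: "x \<in> D \<Longrightarrow> A (c *\<^sub>C x) = c *\<^sub>C A x"
    and D_zero: "0 \<in> D"
    and D_add: "x \<in> D \<Longrightarrow> y \<in> D \<Longrightarrow> x + y \<in> D"
    and D_scaleC: "x \<in> D \<Longrightarrow> c *\<^sub>C x \<in> D"
    and closed_graph: "closed {(x, A x) | x. x \<in> D}"
  using closed_op
  by (auto simp: closed_linear_operator_def complex_vector.subspace_def)

lemma D_scaleR: "x \<in> D \<Longrightarrow> r *\<^sub>R x \<in> D"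
  using D_scaleC[of x "complex_of_real r"] by (simp add: scaleC_of_real)

lemma A_scaleR: "x \<in> D \<Longrightarrow> A (r *\<^sub>R x) = r *\<^sub>R A x"
  using A_scaleC[of x "complex_of_real r"] by (simp add: scaleC_of_real)

lemma A_zero: "A 0 = 0"
  using A_scaleR[OF D_zero, of 0] by simp

lemma D_diff: "x \<in> D \<Longrightarrow> y \<in> D \<Longrightarrow> x - y \<in> D"
  using D_add[of x "- y"] D_scaleR[of y "-1"] by simp

lemma A_diff: "x \<in> D \<Longrightarrow> y \<in> D \<Longrightarrow> A (x - y) = A x - A y"
  using A_add[of x "- y"] A_scaleR[of y "-1"] D_scaleR[of y "-1"] by simp

lemma A_sum:
  assumes "finite K" "\<And>k. k \<in> K \<Longrightarrow> x k \<in> D"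
  shows "sum x K \<in> D \<and> A (sum x K) = (\<Sum>k\<in>K. A (x k))"
  using assms by (induction K rule: finite_induct) (auto simp: A_zero D_zero A_add D_add)

lemma closed_limit:
  assumes "\<And>n. x n \<in> D" "x \<longlonglongrightarrow> l" "(\<lambda>n. A (x n)) \<longlonglongrightarrow> m"
  shows "l \<in> D" "A l = m"
proof -
  have "(l, m) \<in> {(x, A x) | x. x \<in> D}"
    by (rule closed_sequentially[OF closed_graph, of "\<lambda>n. (x n, A (x n))"])
      (use assms in \<open>auto intro: tendsto_Pair\<close>)
  then show "l \<in> D" "A l = m" by auto
qed

definition R :: "int \<Rightarrow> 'a \<Rightarrow> 'a" where
  "R k = resolvent D A (\<i> * of_int k)"

context
  fixes k :: int
  assumes k: "k \<noteq> 0"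
begin

lemma R_in_D: "R k x \<in> D"
  and shifted_R: "A (R k x) - (\<i> * of_int k) *\<^sub>C R k x = x"
  and R_shifted: "y \<in> D \<Longrightarrow> R k (A y - (\<i> * of_int k) *\<^sub>C y) = y"
  and bounded_linear_R: "bounded_linear (R k)"
proof -
  have bij: "bij_betw (shifted A (\<i> * of_int k)) D UNIV"
    and bl: "bounded_linear (R k)"
    using regular[OF k] by (auto simp: regular_point_def R_def)
  show "bounded_linear (R k)" by fact
  show "R k x \<in> D"
    unfolding R_def resolvent_def using bij by (intro inv_into_into) (auto simp: bij_betw_def)
  show "A (R k x) - (\<i> * of_int k) *\<^sub>C R k x = x"
    using f_inv_into_f[of x "shifted A (\<i> * of_int k)" D] bij
    by (auto simp: R_def resolvent_def bij_betw_def shifted_def)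
  show "y \<in> D \<Longrightarrow> R k (A y - (\<i> * of_int k) *\<^sub>C y) = y"
    using inv_into_f_f[of "shifted A (\<i> * of_int k)" D y] bij
    by (auto simp: R_def resolvent_def bij_betw_def shifted_def)
qed

lemma R_add: "R k (x + y) = R k x + R k y"
  by (rule linear_add[OF bounded_linear.linear[OF bounded_linear_R]])

lemma R_diff: "R k (x - y) = R k x - R k y"
  by (rule linear_diff[OF bounded_linear.linear[OF bounded_linear_R]])

text \<open>\<open>bounded_linear\<close> gives real linearity only; complex homogeneity comes from
  \<open>A\<close>, since \<open>c *\<^sub>C R k x\<close> is the preimage of
  \<open>c *\<^sub>C x\<close>.\<close>

lemma R_scaleC: "R k (c *\<^sub>C x) = c *\<^sub>C R k x"
proof -
  have "A (c *\<^sub>C R k x) - (\<i> * of_int k) *\<^sub>C (c *\<^sub>C R k x)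
      = c *\<^sub>C (A (R k x) - (\<i> * of_int k) *\<^sub>C R k x)"
    by (simp add: A_scaleC R_in_D complex_vector.scale_right_diff_distrib scaleC_scaleC mult.commute)
  then show ?thesis
    using R_shifted[OF D_scaleC[OF R_in_D[of x], of c]] by (simp add: shifted_R)
qed

lemma A_R: "A (R k x) = x + (\<i> * of_int k) *\<^sub>C R k x"
  using shifted_R[of x] by (simp add: diff_eq_eq)

lemma R_A: "y \<in> D \<Longrightarrow> R k (A y) = A (R k y)"
  using R_shifted[of y] by (simp add: R_diff R_scaleC A_R diff_eq_eq)

lemma norm_R: "norm (R k x) \<le> C / \<bar>real_of_int k\<bar> * norm x"
  using onorm[OF bounded_linear_R, of x] onorm_resolvent[OF k]
  unfolding R_def by (meson mult_right_mono norm_ge_zero order_trans)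

end

text \<open>Apply \<open>R j\<close> to (A - ij) R_k x = x + i(k-j) R_k x. The identity yields
  commutation, and it makes consecutive resolvents differ by O(1/k^2).\<close>

lemma resolvent_identity:
  assumes "j \<noteq> 0" "k \<noteq> 0"
  shows "R j x - R k x = (\<i> * of_int (j - k)) *\<^sub>C R j (R k x)"
proof -
  have "A (R k x) - (\<i> * of_int j) *\<^sub>C R k x = x + (\<i> * of_int (k - j)) *\<^sub>C R k x"
    by (simp add: A_R assms right_diff_distrib complex_vector.scale_left_diff_distrib)
  then have "R k x = R j x + (\<i> * of_int (k - j)) *\<^sub>C R j (R k x)"
    using R_shifted[of j "R k x"] assms by (simp add: R_in_D R_add R_scaleC)
  then have "R j x - R k x = - ((\<i> * of_int (k - j)) *\<^sub>C R j (R k x))"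
    by (metis add_diff_cancel_left' minus_diff_eq)
  also have "\<dots> = (- (\<i> * of_int (k - j))) *\<^sub>C R j (R k x)"
    by (rule complex_vector.scale_minus_left[symmetric])
  also have "- (\<i> * of_int (k - j)) = \<i> * of_int (j - k)" by (simp add: algebra_simps)
  finally show ?thesis .
qed

text \<open>Exchanging \<open>j\<close> and \<open>k\<close> in the resolvent identity changes the
  sign of the left side and of the scalar, which can be cancelled when \<open>j\<close> and
  \<open>k\<close> differ.\<close>

lemma R_commute:
  assumes "j \<noteq> 0" "k \<noteq> 0"
  shows "R j (R k x) = R k (R j x)"
proof (cases "j = k")
  case False
  have "(\<i> * of_int (j - k)) *\<^sub>C R j (R k x) = - ((\<i> * of_int (k - j)) *\<^sub>C R k (R j x))"
    using resolvent_identity[OF assms, of x] resolvent_identity[OF assms(2,1), of x]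
    by (metis minus_diff_eq)
  also have "\<dots> = (\<i> * of_int (j - k)) *\<^sub>C R k (R j x)"
    by (simp add: complex_vector.scale_minus_left[symmetric] algebra_simps)
  finally show ?thesis using False by simp
qed simp

section \<open>Products of opposite resolvents: bounds and variation\<close>

text \<open>\<open>T k = (A\<^sup>2 + k\<^sup>2 I)\<^sup>-\<^sup>1\<close>.\<close>

definition T :: "nat \<Rightarrow> 'a \<Rightarrow> 'a" where
  "T k x = R (- int k) (R (int k) x)"

context
  fixes k :: nat
  assumes k: "k > 0"
begin

lemma T_in_D: "T k x \<in> D"
  using k by (simp add: T_def R_in_D)

text \<open>Either resolvent in \<open>T k\<close> may be taken as the outer one. The two resulting
  forms of A T_k, added and subtracted, express A T_k and k T_k by single resolvents.\<close>

lemma A_T_minus: "A (T k x) = R (int k) x - (\<i> * of_nat k) *\<^sub>C T k x"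
  using k by (simp add: T_def A_R complex_vector.scale_minus_left)

lemma A_T_plus: "A (T k x) = R (- int k) x + (\<i> * of_nat k) *\<^sub>C T k x"
  using k by (simp add: T_def R_commute[of "- int k"] A_R)

lemma A_T_in_D: "A (T k x) \<in> D"
  unfolding A_T_minus using k by (intro D_diff D_scaleC T_in_D R_in_D) simp

lemma A_A_T: "A (A (T k x)) = x - (real k)\<^sup>2 *\<^sub>R T k x"
proof -
  have "A (A (T k x)) = A (R (int k) x) - (\<i> * of_nat k) *\<^sub>C A (T k x)"
    using k by (subst A_T_minus) (simp add: A_diff A_scaleC D_scaleC R_in_D T_in_D)
  also have "\<dots> = x + ((\<i> * of_nat k) * (\<i> * of_nat k)) *\<^sub>C T k x"
    using k unfolding A_T_minus
    by (simp add: A_R complex_vector.scale_right_diff_distrib scaleC_scaleC)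
  also have "(\<i> * of_nat k) * (\<i> * of_nat k) = complex_of_real (- ((real k)\<^sup>2))"
    by (simp add: power2_eq_square algebra_simps)
  finally show ?thesis by (simp only: scaleC_of_real) simp
qed

lemma T_A: "x \<in> D \<Longrightarrow> T k (A x) = A (T k x)"
  using k by (simp add: T_def R_A R_in_D)

lemma norm_T: "norm (T k x) \<le> C\<^sup>2 * norm x * (1 / (real k)\<^sup>2)"
proof -
  have "norm (T k x) \<le> C / real k * norm (R (int k) x)"
    using norm_R[of "- int k" "R (int k) x"] k by (simp add: T_def)
  also have "\<dots> \<le> C / real k * (C / real k * norm x)"
    using norm_R[of "int k" x] k C_pos by (intro mult_left_mono) auto
  finally show ?thesis by (simp add: power2_eq_square mult_ac)
qed

lemma double_A_T: "2 *\<^sub>R A (T k x) = R (int k) x + R (- int k) x"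
  using A_T_minus[of x] A_T_plus[of x] unfolding scaleR_2 by (simp add: algebra_simps)

lemma double_T: "(2 * \<i>) *\<^sub>C (real k *\<^sub>R T k x) = R (int k) x - R (- int k) x"
proof -
  have "(2 * \<i>) *\<^sub>C (real k *\<^sub>R T k x) = (\<i> * of_nat k + \<i> * of_nat k) *\<^sub>C T k x"
    by (simp add: scaleC_of_real[symmetric] scaleC_scaleC algebra_simps)
  also have "\<dots> = R (int k) x - R (- int k) x"
    using A_T_minus[of x] A_T_plus[of x] unfolding scaleC_add_left by (simp add: algebra_simps)
  finally show ?thesis .
qed

lemma norm_A_T: "norm (A (T k x)) \<le> C * norm x * (1 / real k)"
proof -
  have "2 * norm (A (T k x)) = norm (R (int k) x + R (- int k) x)"
    unfolding double_A_T[symmetric] by simp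
  also have "\<dots> \<le> 2 * (C / real k * norm x)"
    using norm_triangle_ineq[of "R (int k) x" "R (- int k) x"]
      norm_R[of "int k" x] norm_R[of "- int k" x] k by simp
  finally have "norm (A (T k x)) \<le> C / real k * norm x" by linarith
  then show ?thesis by (simp add: mult_ac)
qed

text \<open>On the domain \<open>T k\<close> commutes with \<open>A\<close>, so one application of
  \<open>A\<close> moves onto the argument. The operator that remains is of order 1/k^2, for
  \<open>Upsilon_op\<close> thanks to the factor 1/k.\<close>

lemma
  assumes "x \<in> D"
  shows Sigma_op_eq: "Sigma_op D A k x = T k (A x)"
    and Upsilon_op_eq: "Upsilon_op D A k x = (1 / real k) *\<^sub>R A (T k (A x))"
proof -
  have "T k x = resolvent D A (- (\<i> * of_nat k)) (resolvent D A (\<i> * of_nat k) x)"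
    by (simp add: T_def R_def)
  then show "Sigma_op D A k x = T k (A x)" "Upsilon_op D A k x = (1 / real k) *\<^sub>R A (T k (A x))"
    using T_A[OF assms] by (simp_all add: Sigma_op_def Upsilon_op_def numeral_2_eq_2)
qed

text \<open>For neighbouring indices the scalar in the resolvent identity has modulus one, so the
  difference is as small as a product of two resolvents.\<close>

lemma norm_R_Suc_diff:
  "norm (R (int k) x - R (int (Suc k)) x) \<le> C\<^sup>2 * norm x * (1 / (real k)\<^sup>2)"
  "norm (R (- int k) x - R (- int (Suc k)) x) \<le> C\<^sup>2 * norm x * (1 / (real k)\<^sup>2)"
proof -
  have *: "norm (R i x - R j x) \<le> C\<^sup>2 * norm x * (1 / (real k)\<^sup>2)"
    if "\<bar>i - j\<bar> = 1" "\<bar>i\<bar> = int k" "\<bar>j\<bar> = int (Suc k)" for i j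
  proof -
    have ij: "i \<noteq> 0" "j \<noteq> 0" using that k by auto
    have ri: "\<bar>real_of_int i\<bar> = real k" "\<bar>real_of_int j\<bar> = real (Suc k)"
      using that by (metis of_int_abs of_int_of_nat_eq)+
    have "norm (R i x - R j x) = norm (R i (R j x))"
      unfolding resolvent_identity[OF ij] using that(1)
      by (simp add: norm_scaleC norm_mult norm_of_int[symmetric] del: of_int_diff norm_of_int)
        (metis mult_cancel_right1 norm_of_int of_int_1 of_int_abs)
    also have "\<dots> \<le> C / real k * norm (R j x)"
      using norm_R[OF ij(1), of "R j x"] by (simp add: ri)
    also have "\<dots> \<le> C / real k * (C / real (Suc k) * norm x)"
      using norm_R[OF ij(2), of x] C_pos by (intro mult_left_mono) (auto simp: ri simp del: of_nat_Suc)
    also have "\<dots> \<le> C / real k * (C / real k * norm x)"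
      using C_pos k by (intro mult_left_mono mult_right_mono frac_le) auto
    finally show ?thesis by (simp add: power2_eq_square mult_ac)
  qed
  show "norm (R (int k) x - R (int (Suc k)) x) \<le> C\<^sup>2 * norm x * (1 / (real k)\<^sup>2)"
    "norm (R (- int k) x - R (- int (Suc k)) x) \<le> C\<^sup>2 * norm x * (1 / (real k)\<^sup>2)"
    using *[of "int k" "int (Suc k)"] *[of "- int k" "- int (Suc k)"] by auto
qed

end

text \<open>Termwise bounds of order 1/k would not make the variation summable; passing to single
  resolvents by \<open>double_A_T\<close> and \<open>double_T\<close> gains the missing power of
  k.\<close>

lemma
  assumes k: "k > 0"
  shows norm_A_T_Suc_diff:
      "norm (A (T k x) - A (T (Suc k) x)) \<le> C\<^sup>2 * norm x * (1 / (real k)\<^sup>2)"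
    and norm_T_Suc_diff:
      "norm (real k *\<^sub>R T k x - real (Suc k) *\<^sub>R T (Suc k) x) \<le> C\<^sup>2 * norm x * (1 / (real k)\<^sup>2)"
proof -
  note k' = zero_less_Suc[of k]
  let ?p = "R (int k) x - R (int (Suc k)) x" and ?m = "R (- int k) x - R (- int (Suc k)) x"
  have "2 * norm (A (T k x) - A (T (Suc k) x)) = norm (2 *\<^sub>R A (T k x) - 2 *\<^sub>R A (T (Suc k) x))"
    unfolding scaleR_diff_right[symmetric] by simp
  also have "\<dots> = norm (?p + ?m)"
    unfolding double_A_T[OF k] double_A_T[OF k'] by (simp add: algebra_simps)
  finally show "norm (A (T k x) - A (T (Suc k) x)) \<le> C\<^sup>2 * norm x * (1 / (real k)\<^sup>2)"
    using norm_triangle_ineq[of ?p ?m] norm_R_Suc_diff[OF k, of x] by linarith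
  have "2 * norm (real k *\<^sub>R T k x - real (Suc k) *\<^sub>R T (Suc k) x)
      = norm ((2 * \<i>) *\<^sub>C (real k *\<^sub>R T k x) - (2 * \<i>) *\<^sub>C (real (Suc k) *\<^sub>R T (Suc k) x))"
    unfolding complex_vector.scale_right_diff_distrib[symmetric] norm_scaleC by (simp add: norm_mult)
  also have "\<dots> = norm (?p - ?m)"
    unfolding double_T[OF k] double_T[OF k'] by (simp add: algebra_simps)
  finally show "norm (real k *\<^sub>R T k x - real (Suc k) *\<^sub>R T (Suc k) x) \<le> C\<^sup>2 * norm x * (1 / (real k)\<^sup>2)"
    using norm_triangle_ineq4[of ?p ?m] norm_R_Suc_diff[OF k, of x] by linarith
qed

subsection \<open>Uniqueness\<close>

text \<open>Integration by parts, with the unbounded \<open>A\<close> taken through the integral by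
  a detour: the bounded \<open>R 1\<close> commutes with integration, and R_1 (A - i) is the
  identity on \<open>D\<close>. Thus \<open>a\<close> is a value of \<open>R 1\<close>, which gives
  both membership and formula.\<close>

lemma moment:
  assumes cont: "continuous_on {0..2*pi} u"
    and sol: "\<And>t. t \<in> {0<..<2*pi} \<Longrightarrow> u t \<in> D \<and> (u has_vector_derivative A (u t)) (at t)"
    and \<phi>: "\<And>t. (\<phi> has_real_derivative \<phi>' t) (at t)"
    and a: "((\<lambda>t. \<phi> t *\<^sub>R u t) has_integral a) {0..2*pi}"
    and b: "((\<lambda>t. \<phi>' t *\<^sub>R u t) has_integral b) {0..2*pi}"
  shows "a \<in> D" "A a = \<phi> (2*pi) *\<^sub>R u (2*pi) - \<phi> 0 *\<^sub>R u 0 - b"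
proof -
  let ?c = "\<phi> (2*pi) *\<^sub>R u (2*pi) - \<phi> 0 *\<^sub>R u 0"
  \<comment> \<open>No control of \<open>A (u t)\<close> near the endpoints is assumed: the
    integrand is the derivative of a function continuous up to them, and this supplies the
    integral.\<close>
  have "((\<lambda>t. \<phi>' t *\<^sub>R u t + \<phi> t *\<^sub>R A (u t)) has_integral ?c) {0..2*pi}"
  proof (rule fundamental_theorem_of_calculus_interior)
    show "continuous_on {0..2*pi} (\<lambda>t. \<phi> t *\<^sub>R u t)"
      using \<phi> by (intro continuous_intros cont continuous_at_imp_continuous_on) (auto intro: DERIV_isCont)
    show "((\<lambda>t. \<phi> t *\<^sub>R u t) has_vector_derivative \<phi>' t *\<^sub>R u t + \<phi> t *\<^sub>R A (u t)) (at t)"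
      if "t \<in> {0<..<2*pi}" for t
      using has_vector_derivative_scaleR[OF \<phi> conjunct2[OF sol[OF that]]] by (simp add: add.commute)
  qed simp
  from has_integral_diff[OF has_integral_diff[OF this b]
      has_integral_linear[OF a bounded_linear_scaleC_right[of \<i>]]]
  have "((\<lambda>t. \<phi>' t *\<^sub>R u t + \<phi> t *\<^sub>R A (u t) - \<phi>' t *\<^sub>R u t - \<i> *\<^sub>C (\<phi> t *\<^sub>R u t))
      has_integral ?c - b - \<i> *\<^sub>C a) {0..2*pi}" by (simp add: o_def)
  from has_integral_linear[OF this bounded_linear_R[of 1]]
  have int: "((\<lambda>t. R 1 (\<phi>' t *\<^sub>R u t + \<phi> t *\<^sub>R A (u t) - \<phi>' t *\<^sub>R u t - \<i> *\<^sub>C (\<phi> t *\<^sub>R u t)))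
      has_integral R 1 (?c - b - \<i> *\<^sub>C a)) {0..2*pi}" by (simp add: o_def)
  have "((\<lambda>t. \<phi> t *\<^sub>R u t) has_integral R 1 (?c - b - \<i> *\<^sub>C a)) {0..2*pi}"
  proof (rule has_integral_spike_finite[OF _ _ int])
    \<comment> \<open>Membership of \<open>u t\<close> in \<open>D\<close> is known only inside the
      interval; two points do not affect the integral.\<close>
    show "finite {0, 2*pi}" by simp
    fix t assume "t \<in> {0..2*pi} - {0, 2*pi}"
    then have t: "u t \<in> D" using sol[of t] by auto
    have "\<phi>' t *\<^sub>R u t + \<phi> t *\<^sub>R A (u t) - \<phi>' t *\<^sub>R u t - \<i> *\<^sub>C (\<phi> t *\<^sub>R u t)
        = A (\<phi> t *\<^sub>R u t) - (\<i> * of_int 1) *\<^sub>C (\<phi> t *\<^sub>R u t)"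
      using t by (simp add: A_scaleR)
    then show "\<phi> t *\<^sub>R u t = R 1 (\<phi>' t *\<^sub>R u t + \<phi> t *\<^sub>R A (u t) - \<phi>' t *\<^sub>R u t - \<i> *\<^sub>C (\<phi> t *\<^sub>R u t))"
      using R_shifted[of 1 "\<phi> t *\<^sub>R u t"] t by (simp add: D_scaleR)
  qed
  then have eq: "a = R 1 (?c - b - \<i> *\<^sub>C a)"
    using a has_integral_unique by blast
  then show "a \<in> D" using R_in_D[of 1 "?c - b - \<i> *\<^sub>C a"] by simp
  have "A a - (\<i> * of_int 1) *\<^sub>C a = ?c - b - \<i> *\<^sub>C a"
    using shifted_R[of 1 "?c - b - \<i> *\<^sub>C a"] unfolding eq[symmetric] by simp
  then show "A a = ?c - b" by simp
qed

lemma eigenvector_eq_0: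
  assumes "x \<in> D" "k \<noteq> 0" "A x = (\<i> * of_int k) *\<^sub>C x"
  shows "x = 0"
  using R_shifted[OF assms(2,1)] linear_0[OF bounded_linear.linear[OF bounded_linear_R[OF assms(2)]]]
  by (simp add: assms(3))

text \<open>The cosine and sine coefficients satisfy A c = k d and A d = -k c, so c - id and c + id
  would be eigenvectors for ik and -ik, which regularity excludes.\<close>

lemma homogeneous_solution_eq_0:
  assumes cont: "continuous_on {0..2*pi} u"
    and sol: "\<And>t. t \<in> {0<..<2*pi} \<Longrightarrow> u t \<in> D \<and> (u has_vector_derivative A (u t)) (at t)"
    and mean: "(u has_integral 0) {0..2*pi}"
    and s: "s \<in> {0..2*pi}"
  shows "u s = 0"
proof (rule zero_if_fourier_coefficients_zero[OF cont mean _ _ s])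
  \<comment> \<open>The moment with constant weight 1 is the mean, zero, and \<open>A 0 = 0\<close>;
    hence the boundary terms cancel for the cosines.\<close>
  have periodic: "u (2*pi) = u 0"
    using moment(2)[OF cont sol, of "\<lambda>_. 1" "\<lambda>_. 0" 0 0] mean by (simp add: A_zero)
  fix k
  define c where "c = integral {0..2*pi} (\<lambda>t. cos (real (Suc k) * t) *\<^sub>R u t)"
  define d where "d = integral {0..2*pi} (\<lambda>t. sin (real (Suc k) * t) *\<^sub>R u t)"
  have c: "((\<lambda>t. cos (real (Suc k) * t) *\<^sub>R u t) has_integral c) {0..2*pi}"
    and d: "((\<lambda>t. sin (real (Suc k) * t) *\<^sub>R u t) has_integral d) {0..2*pi}"
    unfolding c_def d_def
    by (intro integrable_integral integrable_continuous_real continuous_intros cont)+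
  have trig: "cos (real (Suc k) * (2*pi)) = 1" "sin (real (Suc k) * (2*pi)) = 0"
    using cos_2npi[of "Suc k"] sin_2npi[of "Suc k"] by (simp_all add: mult_ac del: of_nat_Suc)
  have dcos: "((\<lambda>t. cos (real (Suc k) * t)) has_real_derivative - real (Suc k) * sin (real (Suc k) * t)) (at t)"
    and dsin: "((\<lambda>t. sin (real (Suc k) * t)) has_real_derivative real (Suc k) * cos (real (Suc k) * t)) (at t)" for t
    by (auto intro!: derivative_eq_intros simp del: of_nat_Suc)
  have c': "((\<lambda>t. (real (Suc k) * cos (real (Suc k) * t)) *\<^sub>R u t) has_integral real (Suc k) *\<^sub>R c) {0..2*pi}"
    using has_integral_cmul[OF c, of "real (Suc k)"] by simp
  have d': "((\<lambda>t. (- real (Suc k) * sin (real (Suc k) * t)) *\<^sub>R u t) has_integral - real (Suc k) *\<^sub>R d) {0..2*pi}"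
    using has_integral_cmul[OF d, of "- real (Suc k)"] by simp
  note Ac = moment[OF cont sol dcos c d'] and Ad = moment[OF cont sol dsin d c']
  have Ac': "A c = real (Suc k) *\<^sub>R d"
    using Ac(2) trig periodic by (simp del: of_nat_Suc)
  have Ad': "A d = - (real (Suc k) *\<^sub>R c)"
    using Ad(2) trig periodic by (simp del: of_nat_Suc)
  have R_C: "r *\<^sub>R x = complex_of_real r *\<^sub>C x" for r and x :: 'a by (simp add: scaleC_of_real)
  have "c - \<i> *\<^sub>C d = 0"
  proof (rule eigenvector_eq_0[of _ "int (Suc k)"])
    show "c - \<i> *\<^sub>C d \<in> D" using Ac(1) Ad(1) by (intro D_diff D_scaleC)
    show "A (c - \<i> *\<^sub>C d) = (\<i> * of_int (int (Suc k))) *\<^sub>C (c - \<i> *\<^sub>C d)"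
      using Ac(1) Ad(1)
      by (simp add: A_diff D_scaleC A_scaleC Ac' Ad' R_C complex_vector.scale_right_diff_distrib
          complex_vector.scale_minus_right complex_vector.scale_minus_left algebra_simps scaleC_scaleC
          del: of_nat_Suc scaleC_of_real)
  qed simp
  moreover have "c + \<i> *\<^sub>C d = 0"
  proof (rule eigenvector_eq_0[of _ "- int (Suc k)"])
    show "c + \<i> *\<^sub>C d \<in> D" using Ac(1) Ad(1) by (intro D_add D_scaleC)
    show "A (c + \<i> *\<^sub>C d) = (\<i> * of_int (- int (Suc k))) *\<^sub>C (c + \<i> *\<^sub>C d)"
      using Ac(1) Ad(1)
      by (simp add: A_add D_scaleC A_scaleC Ac' Ad' R_C complex_vector.scale_right_diff_distrib
          complex_vector.scale_minus_right complex_vector.scale_minus_left scaleC_add_right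
          algebra_simps scaleC_scaleC
          del: of_nat_Suc scaleC_of_real)
  qed simp
  ultimately have "2 *\<^sub>R c = 0" and id: "\<i> *\<^sub>C d = c" unfolding scaleR_2
    by (simp_all add: eq_neg_iff_add_eq_0)
  then have "c = 0" by simp
  moreover from this id have "d = 0" by simp
  ultimately show "((\<lambda>t. cos (real (Suc k) * t) *\<^sub>R u t) has_integral 0) {0..2*pi}"
    "((\<lambda>t. sin (real (Suc k) * t) *\<^sub>R u t) has_integral 0) {0..2*pi}"
    using c d by simp_all
qed

lemma solution_unique:
  assumes v: "is_solution D A f v" and w: "is_solution D A f w" and t: "t \<in> {0..2*pi}"
  shows "v t = w t"
proof -
  have vc: "continuous_on {0..2*pi} v" and wc: "continuous_on {0..2*pi} w"
    using v w by (auto simp: is_solution_def)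
  have "integral {0..2*pi} v = integral {0..2*pi} w"
    using v w by (auto simp: is_solution_def)
  then have "((\<lambda>t. v t - w t) has_integral 0) {0..2*pi}"
    using has_integral_diff[OF integrable_integral integrable_integral, OF integrable_continuous_real[OF vc] integrable_continuous_real[OF wc]]
    by simp
  moreover have "v t - w t \<in> D \<and> ((\<lambda>t. v t - w t) has_vector_derivative A (v t - w t)) (at t)"
    if "t \<in> {0<..<2*pi}" for t
    using v w that by (auto simp: is_solution_def A_diff D_diff intro!: derivative_intros)
  ultimately have "v t - w t = 0"
    using homogeneous_solution_eq_0[of "\<lambda>t. v t - w t" t] t by (auto intro!: continuous_intros vc wc)
  then show ?thesis by simp
qed

subsection \<open>Existence and the expansion of the solution\<close>

text \<open>Written through \<open>T\<close>, so that the convergence estimates apply to every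
  \<open>x\<close>; \<open>x = A (A f)\<close> gives the terms in the expansion of the solution.
  Counting starts at 0, hence \<open>Suc k\<close>.\<close>

definition series_term :: "'a \<Rightarrow> nat \<Rightarrow> real \<Rightarrow> 'a" where
  "series_term x k t = cos (real (Suc k) * t) *\<^sub>R T (Suc k) x
    + sin (real (Suc k) * t) *\<^sub>R ((1 / real (Suc k)) *\<^sub>R A (T (Suc k) x))"

definition series_sum :: "'a \<Rightarrow> real \<Rightarrow> 'a" where
  "series_sum x t = (\<Sum>k. series_term x k t)"

lemma norm_cos_term: "norm (cos (real (Suc k) * t) *\<^sub>R T (Suc k) x) \<le> C\<^sup>2 * norm x * (1 / real (Suc k) ^ 2)"
proof -
  have "\<bar>cos (real (Suc k) * t)\<bar> * norm (T (Suc k) x) \<le> 1 * norm (T (Suc k) x)"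
    by (intro mult_right_mono) auto
  then show ?thesis using norm_T[of "Suc k" x] by simp
qed

lemma norm_sin_term:
  "norm (sin (real (Suc k) * t) *\<^sub>R ((1 / real (Suc k)) *\<^sub>R A (T (Suc k) x))) \<le> C * norm x * (1 / real (Suc k) ^ 2)"
proof -
  have "norm (sin (real (Suc k) * t) *\<^sub>R ((1 / real (Suc k)) *\<^sub>R A (T (Suc k) x)))
      = \<bar>sin (real (Suc k) * t)\<bar> * (norm (A (T (Suc k) x)) / real (Suc k))"
    by (simp del: of_nat_Suc)
  also have "\<dots> \<le> 1 * (C * norm x * (1 / real (Suc k)) / real (Suc k))"
    by (intro mult_mono divide_right_mono norm_A_T) auto
  finally show ?thesis by (simp add: power2_eq_square del: of_nat_Suc)
qed

lemma
  shows summable_cos_term: "summable (\<lambda>k. cos (real (Suc k) * t) *\<^sub>R T (Suc k) x)"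
    and summable_sin_term:
      "summable (\<lambda>k. sin (real (Suc k) * t) *\<^sub>R ((1 / real (Suc k)) *\<^sub>R A (T (Suc k) x)))"
  by (rule summable_comparison_test'[OF summable_mult[OF summable_inverse_power_Suc[of 2]]];
      use norm_cos_term norm_sin_term in auto)+

lemma series_uniform_limit:
  "uniform_limit UNIV (\<lambda>n t. \<Sum>k<n. series_term x k t) (series_sum x) sequentially"
  unfolding series_sum_def
proof (rule Weierstrass_m_test)
  show "summable (\<lambda>k. (C\<^sup>2 * norm x + C * norm x) * (1 / real (Suc k) ^ 2))"
    by (intro summable_mult summable_inverse_power_Suc) simp
  show "norm (series_term x k t) \<le> (C\<^sup>2 * norm x + C * norm x) * (1 / real (Suc k) ^ 2)" for k t
    unfolding series_term_def distrib_right
    by (intro norm_triangle_le add_mono norm_cos_term norm_sin_term)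
qed

lemma series_sums: "series_term x k t \<in> D" "(\<lambda>k. series_term x k t) sums series_sum x t"
  using tendsto_uniform_limitI[OF series_uniform_limit, of t x]
  by (auto simp: sums_def series_term_def intro!: D_add D_scaleR T_in_D A_T_in_D)

lemma continuous_on_series_term: "continuous_on S (series_term x k)"
  unfolding series_term_def[abs_def] by (intro continuous_intros)

lemma continuous_on_series_sum: "continuous_on S (series_sum x)"
  by (rule uniform_limit_theorem[OF _ uniform_limit_on_subset[OF series_uniform_limit]])
    (auto intro!: always_eventually continuous_on_sum continuous_on_series_term)

lemma series_sum_has_integral: "(series_sum x has_integral 0) {0..2*pi}"
proof (rule uniform_limit_series_integral[OF uniform_limit_on_subset[OF series_uniform_limit]])
  fix k
  have "((\<lambda>t. cos (real (Suc k) * t - 0) *\<^sub>R T (Suc k) x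
      + cos (real (Suc k) * t - pi/2) *\<^sub>R ((1 / real (Suc k)) *\<^sub>R A (T (Suc k) x)))
      has_integral 0 *\<^sub>R T (Suc k) x + 0 *\<^sub>R ((1 / real (Suc k)) *\<^sub>R A (T (Suc k) x))) {0..2*pi}"
    by (intro has_integral_add has_integral_scaleR_left has_integral_cos_multiple)
  moreover have "cos (real (Suc k) * t - pi/2) = sin (real (Suc k) * t)" for t
    by (simp add: cos_diff)
  ultimately show "(series_term x k has_integral 0) {0..2*pi}"
    by (simp add: series_term_def[abs_def])
qed (auto intro: continuous_on_series_term)

text \<open>For each \<open>x\<close> the sum s of the series solves s' = A s - ((pi - t)/2) x. This
  defect is what the term \<open>(t - pi) *\<^sub>R A f\<close> of the solution compensates.\<close>

lemma series_sum_derivative: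
  obtains G where "\<And>t. t \<in> {0<..<2*pi} \<Longrightarrow> (series_sum x has_vector_derivative G t) (at t)"
    and "\<And>t. t \<in> {0<..<2*pi} \<Longrightarrow>
        series_sum x t \<in> D \<and> A (series_sum x t) = G t + ((pi - t) / 2) *\<^sub>R x"
    and "continuous_on {0<..<2*pi} G"
proof -
  \<comment> \<open>The derivatives of the terms. Their coefficients are only bounded by multiples
    of 1/k, so bounded variation takes the place of a dominating series.\<close>
  define g where "g k t = cos (real (Suc k) * t) *\<^sub>R A (T (Suc k) x)
      - sin (real (Suc k) * t) *\<^sub>R (real (Suc k) *\<^sub>R T (Suc k) x)" for k t
  have lim: "(\<lambda>k. c * (1 / real (Suc k))) \<longlonglongrightarrow> 0" for c :: real
    using tendsto_mult_right_zero[OF inverse_power_bounded_variation(1)[of 1]] by simp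
  have smbl: "summable (\<lambda>k. c * (1 / real (Suc k) ^ 2))" for c :: real
    by (intro summable_mult summable_inverse_power_Suc) simp
  have AT0: "(\<lambda>k. A (T (Suc k) x)) \<longlonglongrightarrow> 0"
    by (rule Lim_null_comparison[OF _ lim[of "C * norm x"]]) (use norm_A_T[of "Suc _" x] in auto)
  have kT0: "(\<lambda>k. real (Suc k) *\<^sub>R T (Suc k) x) \<longlonglongrightarrow> 0"
  proof (rule Lim_null_comparison[OF always_eventually lim[of "C\<^sup>2 * norm x"]], rule allI)
    fix k
    have "norm (real (Suc k) *\<^sub>R T (Suc k) x) \<le> real (Suc k) * (C\<^sup>2 * norm x * (1 / (real (Suc k))\<^sup>2))"
      using mult_left_mono[OF norm_T[of "Suc k" x], of "real (Suc k)"] by (simp del: of_nat_Suc)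
    then show "norm (real (Suc k) *\<^sub>R T (Suc k) x) \<le> C\<^sup>2 * norm x * (1 / real (Suc k))"
      by (simp add: power2_eq_square del: of_nat_Suc)
  qed
  have ATv: "summable (\<lambda>k. norm (A (T (Suc k) x) - A (T (Suc (Suc k)) x)))"
    by (rule summable_comparison_test'[OF smbl[of "C\<^sup>2 * norm x"], of 0])
      (use norm_A_T_Suc_diff[of "Suc _" x] in auto)
  have kTv: "summable (\<lambda>k. norm (real (Suc k) *\<^sub>R T (Suc k) x - real (Suc (Suc k)) *\<^sub>R T (Suc (Suc k)) x))"
    by (rule summable_comparison_test'[OF smbl[of "C\<^sup>2 * norm x"], of 0])
      (use norm_T_Suc_diff[of "Suc _" x] in auto)
  \<comment> \<open>Phases 0 and \<open>pi/2\<close> bring both parts into the form of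
    \<open>trig_series_uniform\<close>.\<close>
  have cosg: "g k t = cos (real (Suc k) * t - 0) *\<^sub>R A (T (Suc k) x)
      - cos (real (Suc k) * t - pi/2) *\<^sub>R (real (Suc k) *\<^sub>R T (Suc k) x)" for k t
    by (simp add: g_def cos_diff del: of_nat_Suc)
  obtain G where G: "\<And>t. t \<in> {0<..<2*pi} \<Longrightarrow> (series_sum x has_vector_derivative G t) (at t)"
      "\<And>t. t \<in> {0<..<2*pi} \<Longrightarrow> (\<lambda>n. g n t) sums G t"
      "continuous_on {0<..<2*pi} G"
  proof (rule series_has_vector_derivative[of "series_term x" g 0 "2*pi" "series_sum x"])
    show "(series_term x k has_vector_derivative g k t) (at t)" for k t
      unfolding series_term_def[abs_def] g_def
      by (auto intro!: derivative_eq_intros simp: algebra_simps simp del: of_nat_Suc)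
    show "continuous_on UNIV (g k)" for k
      unfolding g_def[abs_def] by (intro continuous_intros)
    show "\<exists>G. uniform_limit S (\<lambda>n t. \<Sum>k<n. g k t) G sequentially"
      if S: "compact S" "S \<subseteq> {0<..<2*pi}" for S
    proof -
      obtain G1 where G1: "uniform_limit S (\<lambda>n t. \<Sum>k<n. cos (real (Suc k) * t - 0) *\<^sub>R A (T (Suc k) x)) G1 sequentially"
        using trig_series_uniform[OF AT0 ATv S] by blast
      obtain G2 where G2: "uniform_limit S (\<lambda>n t. \<Sum>k<n. cos (real (Suc k) * t - pi/2) *\<^sub>R (real (Suc k) *\<^sub>R T (Suc k) x)) G2 sequentially"
        using trig_series_uniform[OF kT0 kTv S] by blast
      show ?thesis
        unfolding cosg sum_subtractf using uniform_limit_minus[OF G1 G2] by blast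
    qed
  qed (auto intro: series_sums)
  have "series_sum x t \<in> D \<and> A (series_sum x t) = G t + ((pi - t) / 2) *\<^sub>R x"
    if t: "t \<in> {0<..<2*pi}" for t
  proof -
    \<comment> \<open>\<open>A_A_T\<close> replaces A^2 T_k x by x - k^2 T_k x: the second part
      completes \<open>g\<close>, the first leaves a term of the sawtooth series.\<close>
    have A_term: "A (series_term x k t) = g k t + (sin (real (Suc k) * t) / real (Suc k)) *\<^sub>R x" for k
      by (simp add: series_term_def g_def A_add D_scaleR A_scaleR T_in_D A_T_in_D A_A_T
          scaleR_diff_right power2_eq_square del: of_nat_Suc)
    have partial: "(\<Sum>k<n. series_term x k t) \<in> D"
        "A (\<Sum>k<n. series_term x k t) = (\<Sum>k<n. A (series_term x k t))" for n
      using A_sum[of "{..<n}" "\<lambda>k. series_term x k t"] series_sums(1) by auto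
    have "(\<lambda>k. A (series_term x k t)) sums (G t + ((pi - t) / 2) *\<^sub>R x)"
      unfolding A_term
      by (intro sums_add G(2) t bounded_linear.sums[OF bounded_linear_scaleR_left] sawtooth_sums)
    then have "(\<lambda>n. A (\<Sum>k<n. series_term x k t)) \<longlonglongrightarrow> G t + ((pi - t) / 2) *\<^sub>R x"
      unfolding partial(2) sums_def .
    moreover have "(\<lambda>n. \<Sum>k<n. series_term x k t) \<longlonglongrightarrow> series_sum x t"
      using series_sums(2) unfolding sums_def .
    ultimately show ?thesis
      using closed_limit[of "\<lambda>n. \<Sum>k<n. series_term x k t"] partial(1) by simp
  qed
  then show ?thesis using G(1,3) by (intro that)
qed

lemma solution_exists:
  assumes f: "f \<in> D" "A f \<in> D"
  shows "is_solution D A f (\<lambda>t. f + (t - pi) *\<^sub>R A f + 2 *\<^sub>R series_sum (A (A f)) t)"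
    (is "is_solution D A f ?v")
proof -
  obtain G where G: "\<And>t. t \<in> {0<..<2*pi} \<Longrightarrow> (series_sum (A (A f)) has_vector_derivative G t) (at t)"
    and AG: "\<And>t. t \<in> {0<..<2*pi} \<Longrightarrow> series_sum (A (A f)) t \<in> D \<and>
        A (series_sum (A (A f)) t) = G t + ((pi - t) / 2) *\<^sub>R A (A f)"
    and cG: "continuous_on {0<..<2*pi} G"
    using series_sum_derivative[of "A (A f)"] by blast
  have Dv: "?v t \<in> D" if "t \<in> {0<..<2*pi}" for t
    using f AG[OF that] by (intro D_add D_scaleR) auto
  \<comment> \<open>Twice the defect of the series cancels \<open>A\<close> applied to
    \<open>(t - pi) *\<^sub>R A f\<close>.\<close>
  have Av: "A (?v t) = A f + 2 *\<^sub>R G t" if "t \<in> {0<..<2*pi}" for t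
  proof -
    have "A (?v t) = A f + (t - pi) *\<^sub>R A (A f) + 2 *\<^sub>R (G t + ((pi - t) / 2) *\<^sub>R A (A f))"
      using f AG[OF that] by (simp add: A_add D_add D_scaleR A_scaleR)
    also have "\<dots> = A f + 2 *\<^sub>R G t + ((t - pi) + (pi - t)) *\<^sub>R A (A f)"
      by (simp only: scaleR_add_left scaleR_add_right) simp
    finally show ?thesis by simp
  qed
  have dv: "(?v has_vector_derivative A f + 2 *\<^sub>R G t) (at t)" if "t \<in> {0<..<2*pi}" for t
    by (auto intro!: derivative_eq_intros G that)
  have cd: "continuous_on {0<..<2*pi} (\<lambda>t. A f + 2 *\<^sub>R G t)"
    by (intro continuous_intros cG)
  have "(?v has_integral (2*pi) *\<^sub>R f + 0 *\<^sub>R A f + 2 *\<^sub>R 0) {0..2*pi}"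
  proof (intro has_integral_add has_integral_scaleR_left has_integral_cmul series_sum_has_integral)
    show "((\<lambda>t. f) has_integral (2*pi) *\<^sub>R f) {0..2*pi}"
      using has_integral_const_real[of f 0 "2*pi"] by simp
    show "((\<lambda>t. t - pi) has_integral 0) {0..2*pi}"
      using scaled_bernoulli_has_integral[of 1] scaled_bernoulli_1 by (simp cong: has_integral_cong)
  qed
  then have mean: "(1 / (2*pi)) *\<^sub>R integral {0..2*pi} ?v = f"
    by (simp add: integral_unique)
  have cont: "continuous_on {0..2*pi} ?v"
    by (intro continuous_intros continuous_on_series_sum)
  have C1: "?v C1_differentiable_on {0<..<2*pi}"
    unfolding C1_differentiable_on_def
    by (intro exI[of _ "\<lambda>t. A f + 2 *\<^sub>R G t"] conjI ballI dv cd)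
  have cA: "continuous_on {0<..<2*pi} (\<lambda>t. A (?v t))"
    by (rule continuous_on_eq[OF cd]) (rule Av[symmetric])
  have dA: "(?v has_vector_derivative A (?v t)) (at t)" if "t \<in> {0<..<2*pi}" for t
    unfolding Av[OF that] by (rule dv[OF that])
  show ?thesis
    unfolding is_solution_def by (intro conjI ballI mean cont C1 cA dA Dv)
qed

text \<open>Solving \<open>A_A_T\<close> gives T_k x = (x - T_k A^2 x)/k^2. The first part yields
  Fourier terms of Bernoulli polynomials; the remainder is the same term for A^2 x with an extra
  1/k^2.\<close>

lemma series_term_reduce:
  assumes "x \<in> D" "A x \<in> D"
  shows "series_term x k t = (cos (real (Suc k) * t) / real (Suc k) ^ 2) *\<^sub>R x
      + (sin (real (Suc k) * t) / real (Suc k) ^ 3) *\<^sub>R A x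
      - (1 / real (Suc k) ^ 2) *\<^sub>R series_term (A (A x)) k t"
proof -
  let ?T = "T (Suc k)" and ?q = "1 / (real (Suc k))\<^sup>2"
  have "?T (A (A x)) = x - (real (Suc k))\<^sup>2 *\<^sub>R ?T x"
    using assms by (simp add: T_A A_A_T del: of_nat_Suc)
  then have "?q *\<^sub>R ((real (Suc k))\<^sup>2 *\<^sub>R ?T x) = ?q *\<^sub>R (x - ?T (A (A x)))" by simp
  then have Tx: "?T x = ?q *\<^sub>R (x - ?T (A (A x)))" by (simp del: of_nat_Suc)
  then have ATx: "A (?T x) = ?q *\<^sub>R (A x - A (?T (A (A x))))"
    using assms by (metis A_diff A_scaleR D_diff T_in_D zero_less_Suc)
  show ?thesis
    unfolding series_term_def ATx unfolding Tx
    by (simp add: algebra_simps power2_eq_square power3_eq_cube del: of_nat_Suc)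
qed

text \<open>Induction on \<open>n\<close>: the reduction replaces the remainder series by two
  Bernoulli series minus a new remainder, whence the alternating sign.\<close>

lemma series_expansion:
  assumes "f \<in> power_domain D A (2*n+2)" and t: "t \<in> {0..2*pi}"
  shows "\<exists>S. (\<lambda>k. (1 / real (Suc k) ^ (2*n)) *\<^sub>R series_term ((A ^^ (2*n+2)) f) k t) sums S \<and>
     f + (t - pi) *\<^sub>R A f + 2 *\<^sub>R series_sum (A (A f)) t = poly_part A f n t + ((-1) ^ n * 2) *\<^sub>R S"
  using assms(1)
proof (induction n)
  case 0
  have "poly_part A f 0 t = f + (t - pi) *\<^sub>R A f"
    using scaled_bernoulli_1[of t] by (simp add: poly_part_eq scaled_bernoulli_0)
  then show ?case
    using series_sums(2)[of "A (A f)" t] by (auto simp: numeral_2_eq_2)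
next
  case (Suc n)
  let ?x = "(A ^^ (2*n+2)) f"
  let ?v = "f + (t - pi) *\<^sub>R A f + 2 *\<^sub>R series_sum (A (A f)) t"
  let ?Bc = "(-1) ^ n * scaled_bernoulli (2*n+2) t / 2" and ?Bs = "(-1) ^ n * scaled_bernoulli (2*n+3) t / 2"
  have dom: "f \<in> power_domain D A (2*n+2)" "?x \<in> D" "A ?x \<in> D"
    using Suc.prems unfolding power_domain_iff funpow_Suc_right[symmetric]
    by (auto simp: funpow.simps(2)[symmetric, THEN fun_cong, unfolded o_def] simp del: funpow.simps)
  obtain S where S: "(\<lambda>k. (1 / real (Suc k) ^ (2*n)) *\<^sub>R series_term ?x k t) sums S"
    and v: "?v = poly_part A f n t + ((-1) ^ n * 2) *\<^sub>R S"
    using Suc.IH[OF dom(1)] by blast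
  \<comment> \<open>The reduction is read in reverse: the new remainder is the explicit terms minus
    the old one, so its convergence follows from that of three known series.\<close>
  have step: "(1 / real (Suc k) ^ (2 * Suc n)) *\<^sub>R series_term ((A ^^ (2 * Suc n + 2)) f) k t
      = (cos (real (Suc k) * t) / real (Suc k) ^ (2*n+2)) *\<^sub>R ?x
      + (sin (real (Suc k) * t) / real (Suc k) ^ (2*n+3)) *\<^sub>R A ?x
      - (1 / real (Suc k) ^ (2*n)) *\<^sub>R series_term ?x k t" for k
    unfolding series_term_reduce[OF dom(2,3)]
    by (simp add: scaleR_add_right scaleR_diff_right power_add power2_eq_square power3_eq_cube mult_ac
        del: of_nat_Suc)
  have sums: "(\<lambda>k. (1 / real (Suc k) ^ (2 * Suc n)) *\<^sub>R series_term ((A ^^ (2 * Suc n + 2)) f) k t)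
      sums (?Bc *\<^sub>R ?x + ?Bs *\<^sub>R A ?x - S)"
    unfolding step
    by (intro sums_add sums_diff S bounded_linear.sums[OF bounded_linear_scaleR_left]
        fourier_bernoulli_even fourier_bernoulli_odd t)
  have pp: "poly_part A f (Suc n) t
      = poly_part A f n t + scaled_bernoulli (2*n+2) t *\<^sub>R ?x + scaled_bernoulli (2*n+3) t *\<^sub>R A ?x"
    unfolding poly_part_eq by (simp add: numeral_eq_Suc)
  have "((-1) ^ n * 2) *\<^sub>R (?Bc *\<^sub>R ?x + ?Bs *\<^sub>R A ?x)
      = scaled_bernoulli (2*n+2) t *\<^sub>R ?x + scaled_bernoulli (2*n+3) t *\<^sub>R A ?x"
    by (simp add: scaleR_add_right mult.assoc[symmetric] power_add[symmetric] mult_2[symmetric])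
  then have "?v = poly_part A f (Suc n) t + ((-1) ^ Suc n * 2) *\<^sub>R (?Bc *\<^sub>R ?x + ?Bs *\<^sub>R A ?x - S)"
    unfolding v pp by (simp add: scaleR_diff_right)
  then show ?case using sums by blast
qed

end

section \<open>Existence, uniqueness and both expansions combined\<close>

theorem theorem1:
  fixes D :: "'a::complex_banach set" and A :: "'a \<Rightarrow> 'a" and C :: real and f :: 'a
  assumes "closed_linear_operator D A"
    and "\<And>k::int. k \<noteq> 0 \<Longrightarrow> regular_point D A (\<i> * of_int k)"
    and "C > 0"
    and "\<And>k::int. k \<noteq> 0 \<Longrightarrow> onorm (resolvent D A (\<i> * of_int k)) \<le> C / \<bar>real_of_int k\<bar>"
    and "f \<in> power_domain D A 2"
  shows "(\<exists>v. is_solution D A f v \<and>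
            (\<forall>w. is_solution D A f w \<longrightarrow> (\<forall>t\<in>{0..2*pi}. w t = v t))) \<and>
    (\<forall>v. is_solution D A f v \<longrightarrow>
       (\<forall>t\<in>{0..2*pi}. \<exists>S U.
          (\<lambda>k. cos (real (Suc k) * t) *\<^sub>R Sigma_op D A (Suc k) (A f)) sums S \<and>
          (\<lambda>k. sin (real (Suc k) * t) *\<^sub>R Upsilon_op D A (Suc k) (A f)) sums U \<and>
          v t = f + (t - pi) *\<^sub>R A f + 2 *\<^sub>R (S + U)) \<and>
       (\<forall>n. f \<in> power_domain D A (2*n+2) \<longrightarrow>
          (\<forall>t\<in>{0..2*pi}. \<exists>S.
             (\<lambda>k. (1 / real (Suc k) ^ (2*n)) *\<^sub>R
                (cos (real (Suc k) * t) *\<^sub>R Sigma_op D A (Suc k) ((A ^^ (2*n+1)) f)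
                 + sin (real (Suc k) * t) *\<^sub>R Upsilon_op D A (Suc k) ((A ^^ (2*n+1)) f))) sums S \<and>
             v t = poly_part A f n t + ((-1) ^ n * 2) *\<^sub>R S)))"
proof -
  interpret integer_resolvent_bound D A C
    using assms by unfold_locales
  \<comment> \<open>One explicit solution suffices: uniqueness transfers its formulas to every
    other.\<close>
  define v0 where "v0 t = f + (t - pi) *\<^sub>R A f + 2 *\<^sub>R series_sum (A (A f)) t" for t
  have f: "f \<in> D" "A f \<in> D"
    using assms(5) by (auto simp: power_domain_iff numeral_2_eq_2 less_Suc_eq)
  have v0: "is_solution D A f v0"
    unfolding v0_def by (rule solution_exists[OF f])
  \<comment> \<open>\<open>Sigma_op_eq\<close> and \<open>Upsilon_op_eq\<close> move one more
    \<open>A\<close> onto the argument, which raises the power from 2n+1 to 2n+2.\<close>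
  have ops: "cos (real (Suc k) * t) *\<^sub>R Sigma_op D A (Suc k) ((A ^^ (2*n+1)) f)
      + sin (real (Suc k) * t) *\<^sub>R Upsilon_op D A (Suc k) ((A ^^ (2*n+1)) f)
      = series_term ((A ^^ (2*n+2)) f) k t" if "f \<in> power_domain D A (2*n+2)" for n k t
  proof -
    have "(A ^^ (2*n+1)) f \<in> D" using that by (auto simp: power_domain_iff simp del: funpow.simps)
    then show ?thesis
      by (simp add: series_term_def Sigma_op_eq Upsilon_op_eq del: of_nat_Suc)
  qed
  show ?thesis
  proof (intro conjI exI[of _ v0] allI impI ballI v0)
    show "w t = v0 t" if "is_solution D A f w" "t \<in> {0..2*pi}" for w t
      using solution_unique[OF that(1) v0 that(2)] .
  next
    fix v t assume "is_solution D A f v" and t: "t \<in> {0..2*pi}"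
    then have vt: "v t = v0 t" using solution_unique[OF _ v0] by blast
    let ?S = "\<Sum>k. cos (real (Suc k) * t) *\<^sub>R T (Suc k) (A (A f))"
    let ?U = "\<Sum>k. sin (real (Suc k) * t) *\<^sub>R ((1 / real (Suc k)) *\<^sub>R A (T (Suc k) (A (A f))))"
    \<comment> \<open>The cosine and sine parts converge separately, so the combined series splits
      into the two sums claimed.\<close>
    have sum: "series_sum (A (A f)) t = ?S + ?U"
      unfolding series_sum_def series_term_def
      by (rule suminf_add[symmetric, OF summable_cos_term summable_sin_term])
    show "\<exists>S U.
          (\<lambda>k. cos (real (Suc k) * t) *\<^sub>R Sigma_op D A (Suc k) (A f)) sums S \<and>
          (\<lambda>k. sin (real (Suc k) * t) *\<^sub>R Upsilon_op D A (Suc k) (A f)) sums U \<and>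
          v t = f + (t - pi) *\<^sub>R A f + 2 *\<^sub>R (S + U)"
      unfolding vt v0_def Sigma_op_eq[OF zero_less_Suc f(2)] Upsilon_op_eq[OF zero_less_Suc f(2)] sum
      by (rule exI[of _ ?S], rule exI[of _ ?U])
        (intro conjI summable_sums summable_cos_term summable_sin_term refl)
  next
    fix v n t
    assume "is_solution D A f v" and n: "f \<in> power_domain D A (2*n+2)" and t: "t \<in> {0..2*pi}"
    then have vt: "v t = v0 t" using solution_unique[OF _ v0] by blast
    show "\<exists>S. (\<lambda>k. (1 / real (Suc k) ^ (2*n)) *\<^sub>R
                (cos (real (Suc k) * t) *\<^sub>R Sigma_op D A (Suc k) ((A ^^ (2*n+1)) f)
                 + sin (real (Suc k) * t) *\<^sub>R Upsilon_op D A (Suc k) ((A ^^ (2*n+1)) f))) sums S \<and>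
             v t = poly_part A f n t + ((-1) ^ n * 2) *\<^sub>R S"
      unfolding vt v0_def ops[OF n] by (rule series_expansion[OF n t])
  qed
qed

end
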